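(* Let $Y^0=(Y_1^0,Y_2^0)\in\mathbb{H}^n\times\mathbb{H}^p$ satisfy $\mathcal{A}^\dagger(Y^0)\succ0$ and $\|Y_1^0\|_2\le\gamma$, and set $$\beta=\sigma_{\max}(\mathcal{A}^\dagger)\,\|Y^0-\bar Y\|_F+\|\mathcal{A}^\dagger(\bar Y)\|_2,$$ $$\alpha=\det\mathcal{A}^\dagger(Y^0)\;\beta^{1-n}\,e^{-\langle G,Y_2^0\rangle-\gamma\sqrt n\,\sigma_{\max}(\mathcal{A}_1^\dagger)\operatorname{trace}(\bar X)} .$$ Let $\{Y^k\}$ be the dual iterates of the alternating minimization algorithm started from $Y^0$ with a constant step-size $$0<\rho\le\min\left\{\frac{2\alpha^4}{\beta^2\sigma_{\max}^2(\mathcal{A})},\;\frac{\alpha^2}{\sigma_{\max}^2(\mathcal{A}^\dagger)}\right\}.$$ Then $\{Y^k\}$ converges to $\bar Y$ at a sub-linear rate that is no worse than $O(1/k)$, in the sense of the dual objective value: $$J_d(\bar Y)-J_d(Y^k)\le O(1/k),$$ i.e. there is a constant $c$ independent of $k$ with $J_d(\bar Y)-J_d(Y^k)\le c/k$ for all $k\ge1$.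
   Context: Data: $A\in\mathbb{C}^{n\times n}$ Hurwitz, $C\in\mathbb{C}^{p\times n}$, a Hermitian matrix $G\in\mathbb{C}^{p\times p}$ with partially available entries, the symmetric 0/1 matrix $E$ with $E_{ij}=1$ if $G_{ij}$ is available and $0$ otherwise (unavailable entries of $G$ are set to zero), and $\gamma>0$. $\mathbb{H}^n$ is the set of Hermitian $n\times n$ matrices, $\circ$ is elementwise multiplication, $\langle M_1,M_2\rangle=\operatorname{trace}(M_1^*M_2)$, $\|\cdot\|_2$ is the spectral norm, and for a pair $\|(Y_1,Y_2)\|_F^2=\|Y_1\|_F^2+\|Y_2\|_F^2$. Operators: $$\mathcal{A}_1(X)=AX+XA^*,\quad \mathcal{A}_2(X)=(CXC^* )\circ E,\quad \mathcal{A}(X)=(\mathcal{A}_1(X),\mathcal{A}_2(X)),$$ $$\mathcal{A}_1^\dagger(Y_1)=A^*Y_1+Y_1A,\quad \mathcal{A}_2^\dagger(Y_2)=C^*(E\circ Y_2)C,\quad \mathcal{A}^\dagger(Y)=\mathcal{A}_1^\dagger(Y_1)+\mathcal{A}_2^\dagger(Y_2)\ \text{ for }Y=(Y_1,Y_2).$$ $\sigma_{\max}(\cdot)$ of a linear operator is its largest singular value (operator norm with respect to Frobenius norms). The dual problem is to maximize $J_d(Y)=\log\det\mathcal{A}^\dagger(Y)-\langle G,Y_2\rangle+n$ over $Y=(Y_1,Y_2)\in\mathbb{H}^n\times\mathbb{H}^p$ subject to $\|Y_1\|_2\le\gamma$; it is the Lagrange dual of minimizing $-\log\det X+\gamma\|Z\|_*$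 subject to $\mathcal{A}_1(X)+Z=0$, $\mathcal{A}_2(X)=G$. The dual iterates of the alternating minimization algorithm with step-size $\rho$ are $$Y_1^{k+1}=\mathcal{T}_\gamma\!\left(Y_1^k+\rho\,\mathcal{A}_1(X^{k+1})\right),\quad Y_2^{k+1}=Y_2^k+\rho\left(\mathcal{A}_2(X^{k+1})-G\right),\quad X^{k+1}=\mathcal{A}^\dagger(Y^k)^{-1},$$ where, for a Hermitian $M=U\operatorname{diag}(\sigma_i)U^*$ with $U$ unitary and $\sigma_i$ real, $\mathcal{T}_\gamma(M)=U\operatorname{diag}(\min(\max(\sigma_i,-\gamma),\gamma))U^*$. Standing assumption: there exists an optimal solution $\bar Y=(\bar Y_1,\bar Y_2)$ of the dual problem, which is a fixed point of the dual updates: with $\bar X=\mathcal{A}^\dagger(\bar Y)^{-1}\succ0$, $\bar Y_1=\mathcal{T}_\gamma(\bar Y_1+\rho\mathcal{A}_1(\bar X))$ and $\bar Y_2=\bar Y_2+\rho(\mathcal{A}_2(\bar X)-G)$ (so $\mathcal{A}_2(\bar X)=G$). *)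

theory Defs
  imports "HOL-Analysis.Analysis"
begin

definition conj_transpose :: "complex^'n^'m \<Rightarrow> complex^'m^'n" where
  "conj_transpose M = (\<chi> i j. cnj (M $ j $ i))"

definition hermitian :: "complex^'n^'n \<Rightarrow> bool" where
  "hermitian M \<longleftrightarrow> conj_transpose M = M"

definition unitary :: "complex^'n^'n \<Rightarrow> bool" where
  "unitary U \<longleftrightarrow> conj_transpose U ** U = mat 1 \<and> U ** conj_transpose U = mat 1"

definition pos_def :: "complex^'n^'n \<Rightarrow> bool" where
  "pos_def M \<longleftrightarrow> hermitian M \<and>
     (\<forall>x. x \<noteq> 0 \<longrightarrow> 0 < Re (\<Sum>i\<in>UNIV. cnj (x $ i) * (M *v x) $ i))"

definition hurwitz :: "complex^'n^'n \<Rightarrow> bool" where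
  "hurwitz A \<longleftrightarrow> (\<forall>\<mu> v. v \<noteq> 0 \<and> A *v v = \<mu> *s v \<longrightarrow> Re \<mu> < 0)"

definition real_diag :: "real^'n \<Rightarrow> complex^'n^'n" where
  "real_diag s = (\<chi> i j. if i = j then complex_of_real (s $ i) else 0)"

text \<open>The norm of the type \<^typ>\<open>complex^'n\<close> is the Euclidean one, so this is the spectral norm.
  The library norm of a matrix, by contrast, is its Frobenius norm, and the norm of a pair
  is the square root of the sum of the squared norms.\<close>

definition spectral_norm :: "complex^'n^'m \<Rightarrow> real" where
  "spectral_norm M = onorm (\<lambda>v. M *v v)"

text \<open>\<open>trace (M\<^sub>1\<^sup>* M\<^sub>2)\<close> is real when both matrices are Hermitian, as in every use below.\<close>

definition trace_inner :: "complex^'n^'m \<Rightarrow> complex^'n^'m \<Rightarrow> real" where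
  "trace_inner M1 M2 = Re (trace (conj_transpose M1 ** M2))"

text \<open>In the operators below, \<open>**\<close> is the matrix product, while \<open>*\<close> is the library's
  product of the type \<^typ>\<open>complex^'p^'p\<close>, which is elementwise.\<close>

definition opA1 :: "complex^'n^'n \<Rightarrow> complex^'n^'n \<Rightarrow> complex^'n^'n" where
  "opA1 A X = A ** X + X ** conj_transpose A"

definition opA2 :: "complex^'n^'p \<Rightarrow> complex^'p^'p \<Rightarrow> complex^'n^'n \<Rightarrow> complex^'p^'p" where
  "opA2 C E X = (C ** X ** conj_transpose C) * E"

definition opA ::
  "complex^'n^'n \<Rightarrow> complex^'n^'p \<Rightarrow> complex^'p^'p \<Rightarrow> complex^'n^'n
    \<Rightarrow> (complex^'n^'n) \<times> (complex^'p^'p)" where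
  "opA A C E X = (opA1 A X, opA2 C E X)"

definition opA1_adj :: "complex^'n^'n \<Rightarrow> complex^'n^'n \<Rightarrow> complex^'n^'n" where
  "opA1_adj A Y1 = conj_transpose A ** Y1 + Y1 ** A"

definition opA2_adj :: "complex^'n^'p \<Rightarrow> complex^'p^'p \<Rightarrow> complex^'p^'p \<Rightarrow> complex^'n^'n" where
  "opA2_adj C E Y2 = conj_transpose C ** (E * Y2) ** C"

definition opA_adj ::
  "complex^'n^'n \<Rightarrow> complex^'n^'p \<Rightarrow> complex^'p^'p \<Rightarrow> (complex^'n^'n) \<times> (complex^'p^'p)
    \<Rightarrow> complex^'n^'n" where
  "opA_adj A C E Y = opA1_adj A (fst Y) + opA2_adj C E (snd Y)"

text \<open>Largest singular value of a linear operator, as the operator norm for the Frobenius norms.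
  The supremum runs over all complex matrices rather than over the Hermitian ones only; for the
  complex-linear, Hermitian-preserving operators above both suprema agree, because
  \<open>\<parallel>H + \<i>K\<parallel>\<^sup>2 = \<parallel>H\<parallel>\<^sup>2 + \<parallel>K\<parallel>\<^sup>2\<close> for Hermitian \<open>H\<close> and \<open>K\<close>.\<close>

definition sigma_max :: "('a::real_normed_vector \<Rightarrow> 'b::real_normed_vector) \<Rightarrow> real" where
  "sigma_max L = onorm L"

text \<open>For Hermitian \<open>M\<close> a decomposition exists and the result does not depend on the one chosen.\<close>

definition saturation :: "real \<Rightarrow> complex^'n^'n \<Rightarrow> complex^'n^'n" where
  "saturation \<gamma> M =
     (SOME T. \<exists>U s. unitary U \<and> M = U ** real_diag s ** conj_transpose U \<and>
        T = U ** real_diag (\<chi> i. min (max (s $ i) (- \<gamma>)) \<gamma>) ** conj_transpose U)"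

text \<open>The determinant is a positive real wherever \<open>opA_adj A C E Y\<close> is positive definite; off that
  set the value is meaningless, and \<open>dual_feasible\<close> excludes it.\<close>

definition dual_objective ::
  "complex^'n^'n \<Rightarrow> complex^'n^'p \<Rightarrow> complex^'p^'p \<Rightarrow> complex^'p^'p
    \<Rightarrow> (complex^'n^'n) \<times> (complex^'p^'p) \<Rightarrow> real" where
  "dual_objective A C E G Y =
     ln (Re (det (opA_adj A C E Y))) - trace_inner G (snd Y) + real CARD('n)"

definition dual_feasible ::
  "complex^'n^'n \<Rightarrow> complex^'n^'p \<Rightarrow> complex^'p^'p \<Rightarrow> real
    \<Rightarrow> (complex^'n^'n) \<times> (complex^'p^'p) \<Rightarrow> bool" where
  "dual_feasible A C E \<gamma> Y \<longleftrightarrow>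
     hermitian (fst Y) \<and> hermitian (snd Y) \<and> pos_def (opA_adj A C E Y) \<and>
     spectral_norm (fst Y) \<le> \<gamma>"

definition dual_optimal ::
  "complex^'n^'n \<Rightarrow> complex^'n^'p \<Rightarrow> complex^'p^'p \<Rightarrow> complex^'p^'p \<Rightarrow> real
    \<Rightarrow> (complex^'n^'n) \<times> (complex^'p^'p) \<Rightarrow> bool" where
  "dual_optimal A C E G \<gamma> Y \<longleftrightarrow>
     dual_feasible A C E \<gamma> Y \<and>
     (\<forall>Y'. dual_feasible A C E \<gamma> Y' \<longrightarrow> dual_objective A C E G Y' \<le> dual_objective A C E G Y)"

definition ama_update ::
  "complex^'n^'n \<Rightarrow> complex^'n^'p \<Rightarrow> complex^'p^'p \<Rightarrow> complex^'p^'p \<Rightarrow> real \<Rightarrow> real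
    \<Rightarrow> (complex^'n^'n) \<times> (complex^'p^'p) \<Rightarrow> (complex^'n^'n) \<times> (complex^'p^'p)" where
  "ama_update A C E G \<gamma> \<rho> Y =
     (let X = matrix_inv (opA_adj A C E Y)
      in (saturation \<gamma> (fst Y + \<rho> *\<^sub>R opA1 A X),
          snd Y + \<rho> *\<^sub>R (opA2 C E X - G)))"

end

theory Submission
  imports Defs
begin

text \<open>
  The update is a projected gradient step for the concave function \<open>J\<^sub>d\<close>: the gradient at \<open>Y\<close> is
  \<open>\<A>(\<A>\<^sup>\<dagger>(Y)\<^sup>-\<^sup>1) - (0, G)\<close>, and the saturation of eigenvalues is the orthogonal projection onto the
  spectral norm ball. The difficulty is that \<open>log det\<close> has a Lipschitz gradient only where
  \<open>\<A>\<^sup>\<dagger>(Y)\<close> stays away from the singular matrices.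

  Such a region is the set \<open>S\<close> of feasible \<open>Y\<close> with \<open>\<parallel>Y - Ybar\<parallel> \<le> \<parallel>Y\<^sub>0 - Ybar\<parallel>\<close> and
  \<open>J\<^sub>d(Y) \<ge> J\<^sub>d(Y\<^sub>0)\<close>. On it the distance bound gives \<open>\<A>\<^sup>\<dagger>(Y) \<le> \<beta>\<close>, the objective bound a lower bound on
  the determinant, and the two together \<open>\<A>\<^sup>\<dagger>(Y) \<ge> \<alpha>\<close> (\<open>level_set_lower_bounded\<close>). The optimum lies in
  \<open>S\<close> as well, hence \<open>\<alpha> \<le> \<beta>\<close>.

  The iteration never leaves \<open>S\<close>. The distance to \<open>Ybar\<close> does not increase, because the gradient step
  and the projection are both nonexpansive (\<open>gradient_step_nonexpansive\<close>,
  \<open>variational_nonexpansive\<close>) and \<open>Ybar\<close> is a fixed point. The objective increases by a quadratic lower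
  estimate of \<open>log det\<close> (\<open>log_det_lower_estimate\<close>); this estimate presupposes the bound \<open>\<alpha>\<close> at the new
  point, so that the bound has to be carried along the segment from the old iterate to the new one in
  short steps (\<open>lower_bound_propagates\<close>). The estimate is obtained from first-order concavity alone,
  used on the two halves of the segment. This yields the constant \<open>3/4\<close> in place of the \<open>1/2\<close> that
  integration of the second derivative would give; any constant below \<open>1\<close> suffices.

  Finally, one step satisfies
  \<open>\<delta>\<^sub>k\<^sub>+\<^sub>1 \<le> (\<parallel>Y\<^sub>k - Ybar\<parallel>\<^sup>2 - \<parallel>Y\<^sub>k\<^sub>+\<^sub>1 - Ybar\<parallel>\<^sup>2) / (2 \<rho>) + (\<delta>\<^sub>k - \<delta>\<^sub>k\<^sub>+\<^sub>1)\<close> for the gap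
  \<open>\<delta>\<^sub>k = J\<^sub>d(Ybar) - J\<^sub>d(Y\<^sub>k)\<close>, which telescopes to the rate \<open>1/k\<close> (\<open>telescoping_rate\<close>).
\<close>

section \<open>Adjoints, inner products and norms of complex matrices\<close>

lemma inner_vec_eq: "inner (x::complex^'n) y = Re (\<Sum>i\<in>UNIV. cnj (x $ i) * y $ i)"
  by (simp add: inner_vec_def inner_complex_def)

lemma pos_def_iff: "pos_def M \<longleftrightarrow> hermitian M \<and> (\<forall>x. x \<noteq> 0 \<longrightarrow> 0 < inner x (M *v x))"
  by (simp add: pos_def_def inner_vec_eq)

lemma conj_transpose_nth [simp]: "conj_transpose M $ i $ j = cnj (M $ j $ i)"
  by (simp add: conj_transpose_def)

lemma conj_transpose_conj_transpose [simp]: "conj_transpose (conj_transpose M) = M"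
  by (simp add: vec_eq_iff)

lemma conj_transpose_add: "conj_transpose (M + N) = conj_transpose M + conj_transpose N"
  by (simp add: vec_eq_iff)

lemma conj_transpose_diff: "conj_transpose (M - N) = conj_transpose M - conj_transpose N"
  by (simp add: vec_eq_iff)

lemma conj_transpose_scaleR: "conj_transpose (r *\<^sub>R M) = r *\<^sub>R conj_transpose M"
  by (simp add: vec_eq_iff)

lemma conj_transpose_mat_1 [simp]: "conj_transpose (mat 1) = mat 1"
  by (simp add: vec_eq_iff mat_def)

lemma conj_transpose_mult: "conj_transpose (M ** N) = conj_transpose N ** conj_transpose M"
  by (simp add: vec_eq_iff matrix_matrix_mult_def mult.commute)

lemma conj_transpose_real_diag [simp]: "conj_transpose (real_diag s) = real_diag s"
  by (auto simp: vec_eq_iff real_diag_def)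

lemma matrix_mult_diff_left: "(M - N) ** (K::complex^_^_) = M ** K - N ** K"
  by (simp add: vec_eq_iff matrix_matrix_mult_def algebra_simps sum_subtractf)

lemma matrix_mult_diff_right: "(K::complex^_^_) ** (M - N) = K ** M - K ** N"
  by (simp add: vec_eq_iff matrix_matrix_mult_def algebra_simps sum_subtractf)

lemma matrix_mult_add_left: "(M + N) ** (K::complex^_^_) = M ** K + N ** K"
  by (simp add: vec_eq_iff matrix_matrix_mult_def algebra_simps sum.distrib)

lemma matrix_mult_scaleR_left: "(r *\<^sub>R M) ** (K::complex^_^_) = r *\<^sub>R (M ** K)"
  by (simp add: vec_eq_iff matrix_matrix_mult_def scaleR_sum_right)

lemma matrix_mult_scaleR_right: "(K::complex^_^_) ** (r *\<^sub>R M) = r *\<^sub>R (K ** M)"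
  by (simp add: vec_eq_iff matrix_matrix_mult_def scaleR_sum_right)

lemma complex_matrix_vector_scaleR: "(M::complex^_^_) *v (r *\<^sub>R x) = r *\<^sub>R (M *v x)"
  by (rule linear_cmul[OF matrix_vector_mul_linear])

lemma complex_matrix_scaleR_vector: "(r *\<^sub>R (M::complex^_^_)) *v x = r *\<^sub>R (M *v x)"
  by (simp add: vec_eq_iff matrix_vector_mult_def scaleR_sum_right)

lemma real_diag_nth: "(real_diag s *v y) $ i = s $ i *\<^sub>R y $ i"
  by (simp add: real_diag_def matrix_vector_mult_def if_distrib[where f="\<lambda>a. a * _"] scaleR_conv_of_real cong: if_cong)

lemma inner_matrix_vector_left: "inner (M *v x) y = inner x (conj_transpose M *v y)"
proof -
  have "(\<Sum>i\<in>UNIV. cnj ((M *v x) $ i) * y $ i) = (\<Sum>i\<in>UNIV. \<Sum>j\<in>UNIV. cnj (x $ j) * (cnj (M $ i $ j) * y $ i))"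
    by (simp add: matrix_vector_mult_def sum_distrib_right mult.assoc mult.left_commute)
  also have "\<dots> = (\<Sum>j\<in>UNIV. \<Sum>i\<in>UNIV. cnj (x $ j) * (cnj (M $ i $ j) * y $ i))"
    by (rule sum.swap)
  also have "\<dots> = (\<Sum>j\<in>UNIV. cnj (x $ j) * (conj_transpose M *v y) $ j)"
    by (simp add: matrix_vector_mult_def sum_distrib_left)
  finally show ?thesis by (simp only: inner_vec_eq)
qed

lemma inner_matrix_eq: "inner M N = Re (\<Sum>i\<in>UNIV. \<Sum>j\<in>UNIV. cnj (M $ i $ j) * N $ i $ j)"
  for M N :: "complex^'n^'m"
  by (simp add: inner_vec_def inner_complex_def)

text \<open>With this identity the dual problem lives in a Euclidean space of the library, and
  gradients, projections and adjoints refer to its inner product.\<close>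

lemma trace_inner_eq_inner: "trace_inner M N = inner M N"
proof -
  have "trace (conj_transpose M ** N) = (\<Sum>j\<in>UNIV. \<Sum>i\<in>UNIV. cnj (M $ i $ j) * N $ i $ j)"
    by (simp add: trace_def matrix_matrix_mult_def)
  also have "\<dots> = (\<Sum>i\<in>UNIV. \<Sum>j\<in>UNIV. cnj (M $ i $ j) * N $ i $ j)"
    by (rule sum.swap)
  finally show ?thesis by (simp only: trace_inner_def inner_matrix_eq)
qed

lemma inner_eq_trace: "inner M N = Re (trace (conj_transpose M ** N))"
  by (simp flip: trace_inner_eq_inner add: trace_inner_def)

lemma trace_mult_commute: "trace (M ** N) = trace (N ** M)" for M :: "complex^'n^'m"
proof -
  have "(\<Sum>i\<in>UNIV. \<Sum>j\<in>UNIV. M $ i $ j * N $ j $ i) = (\<Sum>j\<in>UNIV. \<Sum>i\<in>UNIV. M $ i $ j * N $ j $ i)"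
    by (rule sum.swap)
  then show ?thesis by (simp add: trace_def matrix_matrix_mult_def mult.commute)
qed

lemma inner_mult_left: "inner (M ** X) Y = inner X (conj_transpose M ** Y)"
  by (simp add: inner_eq_trace conj_transpose_mult matrix_mul_assoc)

lemma inner_mult_right: "inner (X ** M) Y = inner X (Y ** conj_transpose M)"
proof -
  have "trace (conj_transpose M ** conj_transpose X ** Y) = trace (conj_transpose X ** Y ** conj_transpose M)"
    using trace_mult_commute[of "conj_transpose M" "conj_transpose X ** Y"]
    by (simp add: matrix_mul_assoc)
  then show ?thesis by (simp add: inner_eq_trace conj_transpose_mult matrix_mul_assoc)
qed

lemma inner_conj_transpose: "inner (conj_transpose M) (conj_transpose N) = inner M N"
proof -
  have "inner (conj_transpose M) (conj_transpose N) = (\<Sum>j\<in>UNIV. \<Sum>i\<in>UNIV. inner (M $ i $ j) (N $ i $ j))"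
    by (simp add: inner_vec_def inner_complex_def)
  also have "\<dots> = (\<Sum>i\<in>UNIV. \<Sum>j\<in>UNIV. inner (M $ i $ j) (N $ i $ j))"
    by (rule sum.swap)
  finally show ?thesis by (simp add: inner_vec_def)
qed

lemma norm_conj_transpose [simp]: "norm (conj_transpose M) = norm M"
  by (simp add: norm_eq_sqrt_inner inner_conj_transpose)

lemma column_mat_1: "column j (mat 1) = axis j 1"
  by (simp add: vec_eq_iff column_def mat_def axis_def)

lemma column_mult: "column j (M ** N) = M *v column j N"
  by (simp add: vec_eq_iff column_def matrix_matrix_mult_def matrix_vector_mult_def)

lemma inner_columns: "inner M N = (\<Sum>j\<in>UNIV. inner (column j M) (column j N))" for M N :: "complex^'n^'m"
  by (simp add: inner_vec_def column_def sum.swap[of _ "UNIV::'n set"])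

lemma norm_columns: "(norm M)\<^sup>2 = (\<Sum>j\<in>UNIV. (norm (column j M))\<^sup>2)" for M :: "complex^'n^'m"
  by (simp add: power2_norm_eq_inner inner_columns)

lemma spectral_norm_bound: "norm (M *v x) \<le> spectral_norm M * norm x" for M :: "complex^'n^'m"
  unfolding spectral_norm_def by (rule onorm[OF matrix_vector_mul_bounded_linear])

lemma spectral_norm_leI:
  assumes "\<And>x. norm (M *v x) \<le> b * norm x"
  shows "spectral_norm M \<le> b"
  unfolding spectral_norm_def using assms by (rule onorm_le)

lemma norm_matrix_vector_le: "norm (M *v x) \<le> norm M * norm x" for M :: "complex^'n^'m"
proof -
  have "(norm (M *v x))\<^sup>2 = (\<Sum>i\<in>UNIV. (norm ((M *v x) $ i))\<^sup>2)"
    by (simp add: norm_vec_def L2_set_def sum_nonneg)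
  also have "\<dots> \<le> (\<Sum>i\<in>UNIV. (norm (M $ i))\<^sup>2 * (norm x)\<^sup>2)"
  proof (rule sum_mono)
    fix i
    have "norm ((M *v x) $ i) \<le> (\<Sum>j\<in>UNIV. norm (M $ i $ j) * norm (x $ j))"
      by (simp add: matrix_vector_mult_def) (metis (mono_tags, lifting) norm_mult norm_sum sum.cong)
    also have "\<dots> \<le> norm (M $ i) * norm x"
      using L2_set_mult_ineq[of "\<lambda>j. norm (M $ i $ j)" "\<lambda>j. norm (x $ j)" UNIV]
      by (simp add: norm_vec_def)
    finally show "(norm ((M *v x) $ i))\<^sup>2 \<le> (norm (M $ i))\<^sup>2 * (norm x)\<^sup>2"
      by (metis norm_ge_zero power_mono power_mult_distrib)
  qed
  also have "\<dots> = (norm M * norm x)\<^sup>2"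
    by (simp add: norm_vec_def[of M] L2_set_def sum_nonneg power_mult_distrib sum_distrib_right)
  finally show ?thesis by (rule power2_le_imp_le) simp
qed

lemma norm_le_spectral_norm: "norm M \<le> sqrt (real CARD('n)) * spectral_norm M" for M :: "complex^'n^'m"
proof -
  have nn: "0 \<le> spectral_norm M"
    unfolding spectral_norm_def by (rule onorm_pos_le[OF matrix_vector_mul_bounded_linear])
  have "(norm M)\<^sup>2 \<le> (\<Sum>j\<in>(UNIV::'n set). (spectral_norm M)\<^sup>2)"
    unfolding norm_columns
  proof (rule sum_mono)
    fix j :: 'n
    have "column j M = M *v axis j 1" by (metis column_mult column_mat_1 matrix_mul_rid)
    then have "norm (column j M) \<le> spectral_norm M"
      using spectral_norm_bound[of M "axis j 1"] by (simp add: norm_eq_sqrt_inner[of "axis j _"] inner_axis_axis)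
    then show "(norm (column j M))\<^sup>2 \<le> (spectral_norm M)\<^sup>2" by (simp add: power_mono)
  qed
  also have "\<dots> = (sqrt (real CARD('n)) * spectral_norm M)\<^sup>2" by (simp add: power_mult_distrib)
  finally show ?thesis by (rule power2_le_imp_le) (simp add: nn)
qed

section \<open>The spectral theorem for Hermitian matrices\<close>

text \<open>The library inner product is only the real part of this one. Orthogonality of
  eigenvectors has to hold for the complex product.\<close>

definition cdot :: "complex^'n \<Rightarrow> complex^'n \<Rightarrow> complex" where
  "cdot x y = (\<Sum>i\<in>UNIV. cnj (x $ i) * y $ i)"

lemma cdot_eq: "cdot x y = Complex (inner x y) (inner (\<i> *s x) y)"
  by (simp add: complex_eq_iff cdot_def inner_vec_def inner_complex_def algebra_simps)

lemma cdot_add_right: "cdot x (y + z) = cdot x y + cdot x z"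
  by (simp add: cdot_def algebra_simps sum.distrib)

lemma cdot_diff_right: "cdot x (y - z) = cdot x y - cdot x z"
  by (simp add: cdot_def algebra_simps sum_subtractf)

lemma cdot_scaleR_right: "cdot x (r *\<^sub>R y) = r *\<^sub>R cdot x y"
  by (simp add: cdot_def scaleR_sum_right)

lemma cdot_scaleR_left: "cdot (r *\<^sub>R x) y = r *\<^sub>R cdot x y"
  by (simp add: cdot_def scaleR_sum_right)

lemma cdot_commute: "cdot y x = cnj (cdot x y)"
  by (simp add: cdot_def mult.commute)

lemma matrix_vector_ii: "M *v (\<i> *s x) = \<i> *s (M *v x)"
  by (simp add: vec_eq_iff matrix_vector_mult_def sum_distrib_left mult.left_commute)

lemma cdot_hermitian: "hermitian M \<Longrightarrow> cdot x (M *v y) = cdot (M *v x) y"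
  by (simp add: cdot_eq inner_matrix_vector_left hermitian_def flip: matrix_vector_ii)

lemma inner_hermitian: "hermitian M \<Longrightarrow> inner x (M *v y) = inner (M *v x) y"
  by (simp add: inner_matrix_vector_left hermitian_def)

text \<open>The complex-orthogonal complement \<open>W\<close> of the given eigenvectors is nonzero
  by a count of real dimensions and is invariant under \<open>M\<close>. A maximizer
  \<open>x\<close> of the Rayleigh quotient on the unit sphere of \<open>W\<close> is an
  eigenvector: the residual \<open>z = M x - r x\<close> is itself a direction in \<open>W\<close>,
  and moving along it would increase the quotient to first order by \<open>2
  \<parallel>z\<parallel>\<^sup>2\<close>.\<close>

lemma next_orthogonal_eigenvector:
  fixes M :: "complex^'n^'n"
  assumes M: "hermitian M" and I: "finite I" "card I < CARD('n)"
    and eig: "\<And>i. i \<in> I \<Longrightarrow> M *v v i = s i *\<^sub>R v i"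
  obtains x r where "norm x = 1" "\<And>i. i \<in> I \<Longrightarrow> cdot (v i) x = 0" "M *v x = r *\<^sub>R x"
proof -
  define W where "W = {x. \<forall>i\<in>I. cdot (v i) x = 0}"
  define S where "S = v ` I \<union> (\<lambda>i. \<i> *s v i) ` I"
  have fin: "finite S" using I by (simp add: S_def)
  have "card S \<le> card I + card I"
    unfolding S_def by (rule order_trans[OF card_Un_le]) (intro add_mono card_image_le I)
  then have "dim S < DIM(complex^'n)"
    using I(2) dim_le_card'[OF fin] by simp
  then obtain x0 where x0: "x0 \<noteq> 0" "\<And>y. y \<in> span S \<Longrightarrow> orthogonal x0 y"
    using orthogonal_to_subspace_exists by blast
  have "x0 \<in> W"
    using x0(2)[OF span_base] by (auto simp: W_def S_def cdot_eq orthogonal_def inner_commute[of _ x0] complex_eq_iff)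
  moreover have scaleW: "c *\<^sub>R x \<in> W" if "x \<in> W" for c x
    using that by (simp add: W_def cdot_scaleR_right)
  ultimately have "(1 / norm x0) *\<^sub>R x0 \<in> sphere 0 1 \<inter> W"
    using x0(1) by simp
  then have ne: "sphere 0 1 \<inter> W \<noteq> {}" by blast
  have "W = (\<Inter>i\<in>I. {x. inner (v i) x = 0} \<inter> {x. inner (\<i> *s v i) x = 0})"
    by (auto simp: W_def cdot_eq complex_eq_iff)
  then have "closed W" by (auto intro!: closed_INT closed_Int closed_hyperplane)
  then have cpt: "compact (sphere 0 1 \<inter> W)" by (simp add: compact_Int_closed)
  have "continuous_on (sphere 0 1 \<inter> W) (\<lambda>x. inner x (M *v x))"
    by (intro continuous_intros linear_continuous_on matrix_vector_mul_bounded_linear)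
  from continuous_attains_sup[OF cpt ne this]
  obtain x where x: "norm x = 1" "x \<in> W"
    and max: "\<And>y. norm y = 1 \<Longrightarrow> y \<in> W \<Longrightarrow> inner y (M *v y) \<le> inner x (M *v x)"
    by auto
  define r where "r = inner x (M *v x)"
  have max': "inner y (M *v y) \<le> r * (norm y)\<^sup>2" if "y \<in> W" for y
  proof (cases "y = 0")
    case False
    have "inner y (M *v y) / (norm y)\<^sup>2 \<le> r"
      using max[of "(1 / norm y) *\<^sub>R y"] scaleW[OF that] False
      by (simp add: r_def complex_matrix_vector_scaleR power2_eq_square)
    then show ?thesis using False by (simp add: pos_divide_le_eq)
  qed simp
  define z where "z = M *v x - r *\<^sub>R x"
  have zW: "z \<in> W"
    unfolding W_def
  proof safe
    fix i assume i: "i \<in> I"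
    have "cdot (v i) (M *v x) = cdot (M *v v i) x" by (rule cdot_hermitian[OF M])
    also have "\<dots> = 0" using i x(2) by (simp add: eig cdot_scaleR_left W_def)
    finally show "cdot (v i) z = 0"
      using i x(2) by (simp add: z_def cdot_diff_right cdot_scaleR_right W_def)
  qed
  define c where "c = r * (norm z)\<^sup>2 - inner z (M *v z)"
  have quad: "2 * t * (norm z)\<^sup>2 \<le> t\<^sup>2 * c" for t
  proof -
    have "x + t *\<^sub>R z \<in> W"
      using x(2) zW by (simp add: W_def cdot_add_right cdot_scaleR_right)
    from max'[OF this] have "inner (x + t *\<^sub>R z) (M *v (x + t *\<^sub>R z)) \<le> r * inner (x + t *\<^sub>R z) (x + t *\<^sub>R z)"
      by (simp add: power2_norm_eq_inner)
    moreover have "inner x (M *v z) = inner z (M *v x)"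
      using inner_hermitian[OF M, of x z] by (simp add: inner_commute)
    moreover have "inner x x = 1" using x(1) by (simp add: norm_eq_1)
    ultimately have "2 * t * inner z (M *v x) + t\<^sup>2 * inner z (M *v z) \<le> r * (2 * t * inner z x + t\<^sup>2 * inner z z)"
      by (simp add: complex_matrix_vector_scaleR matrix_vector_right_distrib inner_add_left inner_add_right
        inner_commute[of x z] r_def[symmetric] algebra_simps power2_eq_square)
    moreover have "inner z (M *v x) = inner z z + r * inner z x"
      by (simp add: z_def inner_diff_right inner_diff_left)
    ultimately show ?thesis by (simp add: c_def power2_norm_eq_inner algebra_simps)
  qed
  have "z = 0"
  proof (rule ccontr)
    assume "z \<noteq> 0"
    define q where "q = (norm z)\<^sup>2"
    have q: "0 < q" using \<open>z \<noteq> 0\<close> by (simp add: q_def)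
    \<comment> \<open>Any step below \<open>2 q / \<bar>c\<bar>\<close> contradicts the quadratic bound; the summand 1 avoids division by zero.\<close>
    define t where "t = q / (\<bar>c\<bar> + 1)"
    have t: "0 < t" using q by (simp add: t_def)
    have "2 * q \<le> t * c" using quad[of t] t by (simp add: q_def power2_eq_square)
    also have "\<dots> \<le> t * (\<bar>c\<bar> + 1)" using t by (intro mult_left_mono) auto
    also have "\<dots> = q" by (simp add: t_def)
    finally show False using q by simp
  qed
  then have "M *v x = r *\<^sub>R x" by (simp add: z_def)
  with x that show thesis by (auto simp: W_def)
qed

lemma unitary_of_orthonormal_columns:
  fixes v :: "'n \<Rightarrow> complex^'n"
  assumes "\<And>i j. cdot (v i) (v j) = (if i = j then 1 else 0)"
  shows "unitary (\<chi> k i. v i $ k)"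
proof -
  have "conj_transpose (\<chi> k i. v i $ k) ** (\<chi> k i. v i $ k) = mat 1"
    using assms by (simp add: vec_eq_iff matrix_matrix_mult_def mat_def cdot_def)
  then show ?thesis by (simp add: unitary_def matrix_left_right_inverse)
qed

theorem spectral_theorem:
  fixes M :: "complex^'n^'n"
  assumes M: "hermitian M"
  obtains U s where "unitary U" "M = U ** real_diag s ** conj_transpose U"
proof -
  have "\<exists>v s. (\<forall>i\<in>I. \<forall>j\<in>I. cdot (v i) (v j) = (if i = j then 1 else 0)) \<and>
        (\<forall>i\<in>I. M *v v i = s i *\<^sub>R v i)" for I :: "'n set"
    using finite[of I]
  proof (induction I rule: finite_induct)
    case (insert a I)
    then obtain v s where v: "\<forall>i\<in>I. \<forall>j\<in>I. cdot (v i) (v j) = (if i = j then 1 else 0)"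
      and s: "\<forall>i\<in>I. M *v v i = s i *\<^sub>R v i" by blast
    have "card I < CARD('n)"
      using insert.hyps by (metis UNIV_I finite psubsetI psubset_card_mono subset_UNIV)
    from next_orthogonal_eigenvector[OF M insert.hyps(1) this, of v s] s
    obtain x r where x: "norm x = 1" "\<And>i. i \<in> I \<Longrightarrow> cdot (v i) x = 0" "M *v x = r *\<^sub>R x"
      by blast
    have "cdot x x = complex_of_real ((norm x)\<^sup>2)"
      by (simp add: cdot_def complex_norm_square norm_vec_def L2_set_def sum_nonneg mult.commute del: of_real_power)
    then have "cdot x x = 1" by (simp add: x(1))
    moreover have "cdot x (v i) = 0" if "i \<in> I" for i
      using x(2)[OF that] cdot_commute[of x "v i"] by simp
    ultimately show ?case
      using v s x insert.hyps(2)
      by (intro exI[of _ "v(a := x)"] exI[of _ "s(a := r)"]) auto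
  qed auto
  from this[of UNIV] obtain v :: "'n \<Rightarrow> complex^'n" and s :: "'n \<Rightarrow> real" where
    v: "\<And>i j. cdot (v i) (v j) = (if i = j then 1 else 0)" and s: "\<And>i. M *v v i = s i *\<^sub>R v i"
    by auto
  define U where "U = (\<chi> k i. v i $ k)"
  have U: "unitary U" unfolding U_def by (rule unitary_of_orthonormal_columns) (rule v)
  have "M ** U = U ** real_diag (\<chi> i. s i)"
  proof -
    have "(M ** U) $ k $ i = (U ** real_diag (\<chi> i. s i)) $ k $ i" for k i
    proof -
      have "(M ** U) $ k $ i = (M *v v i) $ k"
        by (simp add: U_def matrix_matrix_mult_def matrix_vector_mult_def)
      also have "\<dots> = (U ** real_diag (\<chi> i. s i)) $ k $ i"
        by (simp add: s U_def matrix_matrix_mult_def real_diag_def if_distrib[where f="\<lambda>a. _ * a"]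
          scaleR_conv_of_real[where 'a=complex] mult.commute cong: if_cong)
      finally show ?thesis .
    qed
    then show ?thesis by (simp add: vec_eq_iff)
  qed
  then have "M = U ** real_diag (\<chi> i. s i) ** conj_transpose U"
    using U by (metis matrix_mul_assoc matrix_mul_rid unitary_def)
  with U that show thesis by blast
qed

section \<open>Positive definite matrices and concavity of the log-determinant\<close>

lemma unitary_mult_cancel:
  assumes "unitary U"
  shows "conj_transpose U ** (U ** N) = N" "U ** (conj_transpose U ** N) = N"
  using assms by (simp_all add: unitary_def matrix_mul_assoc)

lemma real_diag_mult: "real_diag s ** real_diag t = real_diag (\<chi> i. s $ i * t $ i)"
  by (simp add: vec_eq_iff matrix_matrix_mult_def real_diag_def if_distrib[where f="\<lambda>a. a * _"] cong: if_cong)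

lemma unitary_diag_mult:
  assumes "unitary U"
  shows "(U ** real_diag s ** conj_transpose U) ** (U ** real_diag t ** conj_transpose U)
    = U ** real_diag (\<chi> i. s $ i * t $ i) ** conj_transpose U"
  by (simp add: unitary_mult_cancel[OF assms] flip: matrix_mul_assoc real_diag_mult)

lemma hermitian_unitary_diag: "hermitian (U ** real_diag s ** conj_transpose U)"
  by (simp add: hermitian_def conj_transpose_mult matrix_mul_assoc)

lemma unitary_norm:
  assumes "unitary U"
  shows "norm (conj_transpose U *v x) = norm x"
  using assms by (simp add: norm_eq_sqrt_inner inner_matrix_vector_left matrix_vector_mul_assoc unitary_def)

lemma unitary_diag_form:
  "inner x ((U ** real_diag s ** conj_transpose U) *v x) = (\<Sum>i\<in>UNIV. s $ i * (norm ((conj_transpose U *v x) $ i))\<^sup>2)"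
proof -
  have "inner x ((U ** real_diag s ** conj_transpose U) *v x)
      = inner (conj_transpose U *v x) (real_diag s *v (conj_transpose U *v x))"
    by (simp add: inner_matrix_vector_left matrix_vector_mul_assoc matrix_mul_assoc)
  then show ?thesis by (simp add: inner_vec_def real_diag_nth power2_norm_eq_inner)
qed

lemma unitary_column:
  assumes "unitary U"
  shows "conj_transpose U *v column i U = axis i 1" "norm (column i U) = 1"
proof -
  show *: "conj_transpose U *v column i U = axis i 1"
    using assms by (simp add: column_mat_1 unitary_def flip: column_mult)
  show "norm (column i U) = 1"
    using unitary_norm[OF assms, of "column i U"] by (simp add: * norm_eq_sqrt_inner[of "axis i _"] inner_axis_axis)
qed

lemma unitary_diag_eigenvalue:
  assumes "unitary U"
  shows "inner (column i U) ((U ** real_diag s ** conj_transpose U) *v column i U) = s $ i"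
  by (simp add: unitary_diag_form unitary_column[OF assms] axis_def if_distrib[where f=norm]
    if_distrib[where f="\<lambda>a. a\<^sup>2"] if_distrib[where f="\<lambda>a. _ * a"] cong: if_cong)

lemma det_unitary_diag:
  assumes "unitary U"
  shows "det (U ** real_diag s ** conj_transpose U) = complex_of_real (\<Prod>i\<in>UNIV. s $ i)"
proof -
  have "det (real_diag s) = (\<Prod>i\<in>UNIV. complex_of_real (s $ i))"
    by (subst det_diagonal) (simp_all add: real_diag_def)
  moreover have "det U * det (conj_transpose U) = 1"
    using assms by (simp add: unitary_def flip: det_mul)
  ultimately show ?thesis
    by (simp add: det_mul mult.commute mult.left_commute)
qed

lemma trace_unitary_diag:
  assumes "unitary U"
  shows "trace (U ** real_diag s ** conj_transpose U) = complex_of_real (\<Sum>i\<in>UNIV. s $ i)"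
  unfolding matrix_mul_assoc[symmetric] using trace_mult_commute[of U "real_diag s ** conj_transpose U"] assms
  by (simp add: unitary_def trace_def real_diag_def flip: matrix_mul_assoc)

text \<open>This is the Loewner order \<open>a I \<le> M\<close>.\<close>

definition lower_bounded :: "real \<Rightarrow> complex^'n^'n \<Rightarrow> bool" where
  "lower_bounded a M \<longleftrightarrow> hermitian M \<and> (\<forall>x. a * (norm x)\<^sup>2 \<le> inner x (M *v x))"

lemma lower_bounded_pos_def: "lower_bounded a M \<Longrightarrow> 0 < a \<Longrightarrow> pos_def M"
  unfolding lower_bounded_def pos_def_iff
  by (metis less_le_trans mult_pos_pos zero_less_norm_iff zero_less_power)

lemma pos_def_lower_bounded: "pos_def M \<Longrightarrow> lower_bounded 0 M"
  unfolding lower_bounded_def pos_def_iff by (metis inner_zero_left less_eq_real_def mult_zero_left)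

lemma lower_bounded_mono: "lower_bounded a M \<Longrightarrow> b \<le> a \<Longrightarrow> lower_bounded b M"
  unfolding lower_bounded_def by (meson mult_right_mono order_trans zero_le_power2)

lemma pos_def_eigenvalues_pos:
  assumes "pos_def (U ** real_diag s ** conj_transpose U)" "unitary U"
  shows "0 < s $ i"
  using assms unitary_diag_eigenvalue[OF assms(2), of i s] unitary_column(2)[OF assms(2), of i]
  by (metis norm_zero pos_def_iff zero_neq_one)

text \<open>The root turns trace expressions in \<open>P\<close> into squared norms and congruences;
  its inverse \<open>R\<close> normalizes \<open>P\<close> to the identity.\<close>

lemma pos_def_sqrt:
  assumes P: "pos_def P"
  obtains S R where "hermitian S" "hermitian R" "S ** S = P" "S ** R = mat 1" "R ** S = mat 1"
proof -
  obtain U s where U: "unitary U" and P': "P = U ** real_diag s ** conj_transpose U"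
    using spectral_theorem P pos_def_iff by blast
  have s: "0 < s $ i" for i using P U unfolding P' by (rule pos_def_eigenvalues_pos)
  have one: "real_diag (\<chi> i. 1) = mat 1" by (simp add: real_diag_def mat_def vec_eq_iff)
  define S where "S = U ** real_diag (\<chi> i. sqrt (s $ i)) ** conj_transpose U"
  define R where "R = U ** real_diag (\<chi> i. 1 / sqrt (s $ i)) ** conj_transpose U"
  show thesis
  proof
    show "hermitian S" "hermitian R" by (simp_all add: S_def R_def hermitian_unitary_diag)
    show "S ** S = P" using s by (simp add: S_def P' unitary_diag_mult[OF U] less_imp_le)
    show "S ** R = mat 1" "R ** S = mat 1"
      using s U by (simp_all add: S_def R_def unitary_diag_mult[OF U] less_imp_neq[symmetric] one unitary_def)
  qed
qed

lemma pos_def_det: "pos_def P \<Longrightarrow> det P = complex_of_real (Re (det P)) \<and> 0 < Re (det P)"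
proof -
  assume P: "pos_def P"
  then obtain U s where U: "unitary U" and P': "P = U ** real_diag s ** conj_transpose U"
    using spectral_theorem pos_def_iff by blast
  have "0 < s $ i" for i using P U unfolding P' by (rule pos_def_eigenvalues_pos)
  then show ?thesis by (simp add: P' det_unitary_diag[OF U] prod_pos del: of_real_prod)
qed

lemma pos_def_congruence:
  assumes "pos_def Q" "hermitian R" "S ** R = mat 1"
  shows "pos_def (R ** Q ** R)"
proof -
  have "R *v x \<noteq> 0" if "x \<noteq> 0" for x
    using that assms(3) by (metis matrix_vector_mul_assoc matrix_vector_mul_lid matrix_vector_mult_0_right)
  moreover have "inner x ((R ** Q ** R) *v x) = inner (R *v x) (Q *v (R *v x))" for x
    using assms(2) by (simp add: inner_matrix_vector_left hermitian_def matrix_vector_mul_assoc matrix_mul_assoc)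
  ultimately show ?thesis
    using assms(1,2) by (simp add: pos_def_iff hermitian_def conj_transpose_mult matrix_mul_assoc)
qed

lemma matrix_invI:
  fixes M :: "complex^'n^'n"
  assumes "M ** N = mat 1"
  shows "matrix_inv M = N"
proof -
  have "N ** M = mat 1" using assms by (simp add: matrix_left_right_inverse)
  with assms have "\<exists>N. M ** N = mat 1 \<and> N ** M = mat 1" by blast
  from someI_ex[OF this] have "M ** matrix_inv M = mat 1" by (simp only: matrix_inv_def)
  then have "N ** (M ** matrix_inv M) = N" by simp
  then show ?thesis by (simp add: matrix_mul_assoc \<open>N ** M = mat 1\<close>)
qed

lemma right_inverse_cancel: "S ** R = mat 1 \<Longrightarrow> S ** (R ** N) = N"
  by (simp add: matrix_mul_assoc)

lemma pos_def_matrix_inv: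
  assumes "pos_def P"
  shows "P ** matrix_inv P = mat 1" "matrix_inv P ** P = mat 1" "pos_def (matrix_inv P)"
proof -
  obtain S R where SR: "hermitian S" "hermitian R" "S ** S = P" "S ** R = mat 1" "R ** S = mat 1"
    using pos_def_sqrt[OF assms] by blast
  have "P ** (R ** R) = mat 1"
    by (simp add: right_inverse_cancel[OF SR(4)] SR(4) flip: SR(3) matrix_mul_assoc)
  then have inv: "matrix_inv P = R ** R" by (rule matrix_invI)
  show *: "P ** matrix_inv P = mat 1" by (simp add: inv \<open>P ** (R ** R) = mat 1\<close>)
  then show "matrix_inv P ** P = mat 1" by (simp add: matrix_left_right_inverse)
  have "pos_def (mat 1 :: complex^'n^'n)"
    by (simp add: pos_def_iff hermitian_def)
  from pos_def_congruence[OF this SR(2,4)] show "pos_def (matrix_inv P)" by (simp add: inv)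
qed

lemma trace_mat_1: "trace (mat 1 :: complex^'n^'n) = of_nat CARD('n)"
  by (simp add: trace_def mat_def)

text \<open>This is concavity of \<open>log det\<close> in first-order form. After the congruence by
  \<open>R = P\<^sup>-\<^sup>1\<^sup>/\<^sup>2\<close> it becomes a statement on the eigenvalues
  \<open>m\<^sub>i\<close> of \<open>R Q R\<close>, namely the sum of \<open>ln m\<^sub>i \<le>
  m\<^sub>i - 1\<close>.\<close>

lemma log_det_concave:
  fixes P Q :: "complex^'n^'n"
  assumes P: "pos_def P" and Q: "pos_def Q"
  shows "ln (Re (det Q)) - ln (Re (det P)) \<le> inner (matrix_inv P) (Q - P)"
proof -
  obtain S R where SR: "hermitian S" "hermitian R" "S ** S = P" "S ** R = mat 1" "R ** S = mat 1"
    using pos_def_sqrt[OF P] by blast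
  have inv: "matrix_inv P = R ** R"
    by (rule matrix_invI) (simp add: right_inverse_cancel[OF SR(4)] SR(4) flip: SR(3) matrix_mul_assoc)
  define N where "N = R ** Q ** R"
  have N: "pos_def N" unfolding N_def by (rule pos_def_congruence[OF Q SR(2,4)])
  then obtain U m where U: "unitary U" and N': "N = U ** real_diag m ** conj_transpose U"
    using spectral_theorem pos_def_iff by blast
  have m: "0 < m $ i" for i using N U unfolding N' by (rule pos_def_eigenvalues_pos)
  have RPR: "R ** P ** R = mat 1"
    by (simp add: right_inverse_cancel[OF SR(5)] SR(4) flip: SR(3) matrix_mul_assoc)
  have inner_R: "inner (R ** R) Z = Re (trace (R ** Z ** R))" for Z
    using SR(2) inner_mult_left[of R "mat 1 ** R" Z] inner_mult_right[of "mat 1" R "R ** Z"]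
    by (simp add: hermitian_def inner_eq_trace[of "mat 1"])
  have "inner (matrix_inv P) (Q - P) = Re (trace N) - Re (trace (R ** P ** R))"
    by (simp add: inv inner_diff_right inner_R N_def)
  also have "\<dots> = (\<Sum>i\<in>UNIV. m $ i - 1)"
    by (simp add: N' trace_unitary_diag[OF U] RPR sum_subtractf trace_mat_1 del: of_real_sum)
  finally have tr: "inner (matrix_inv P) (Q - P) = (\<Sum>i\<in>UNIV. m $ i - 1)" .
  have "det (R ** P ** R) = 1" by (simp add: RPR)
  then have "det N * det P = det Q"
    by (simp add: N_def det_mul mult_ac)
  then have "Re (det N) * Re (det P) = Re (det Q)"
    using pos_def_det[OF N] pos_def_det[OF P] by (metis Re_complex_of_real of_real_mult)
  then have "ln (Re (det Q)) = ln (Re (det N)) + ln (Re (det P))"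
    using pos_def_det[OF N] pos_def_det[OF P] by (metis ln_mult_pos)
  moreover have "ln (Re (det N)) = (\<Sum>i\<in>UNIV. ln (m $ i))"
    by (simp add: N' det_unitary_diag[OF U] ln_prod m less_imp_neq[symmetric] del: of_real_prod)
  moreover have "(\<Sum>i\<in>UNIV. ln (m $ i)) \<le> (\<Sum>i\<in>UNIV. m $ i - 1)"
    by (intro sum_mono ln_le_minus_one m)
  ultimately show ?thesis using tr by simp
qed

text \<open>Each eigenvalue is the determinant divided by the product of the other eigenvalues, all
  of which are at most \<open>b\<close>.\<close>

lemma lower_bounded_by_det:
  fixes M :: "complex^'n^'n"
  assumes M: "pos_def M" and b: "0 < b" and ub: "\<And>x. inner x (M *v x) \<le> b * (norm x)\<^sup>2"
  shows "lower_bounded (Re (det M) / b ^ (CARD('n) - 1)) M"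
proof -
  obtain U s where U: "unitary U" and M': "M = U ** real_diag s ** conj_transpose U"
    using spectral_theorem M pos_def_iff by blast
  have s: "0 < s $ i" for i using M U unfolding M' by (rule pos_def_eigenvalues_pos)
  have sb: "s $ i \<le> b" for i
    using ub[of "column i U"] by (simp add: M' unitary_diag_eigenvalue[OF U] unitary_column[OF U])
  have low: "Re (det M) / b ^ (CARD('n) - 1) \<le> s $ i" for i
  proof -
    have "Re (det M) = s $ i * (\<Prod>j\<in>UNIV - {i}. s $ j)"
      by (simp add: M' det_unitary_diag[OF U] prod.remove[of UNIV i] del: of_real_prod)
    also have "\<dots> \<le> s $ i * (\<Prod>j\<in>UNIV - {i}. b)"
      using s sb by (intro mult_left_mono prod_mono) (auto simp: less_imp_le)
    finally show ?thesis using b by (simp add: pos_divide_le_eq)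
  qed
  have "Re (det M) / b ^ (CARD('n) - 1) * (norm x)\<^sup>2 \<le> inner x (M *v x)" for x
  proof -
    have "(norm x)\<^sup>2 = (\<Sum>i\<in>UNIV. (norm ((conj_transpose U *v x) $ i))\<^sup>2)"
      unfolding unitary_norm[OF U, of x, symmetric] by (simp add: norm_vec_def L2_set_def sum_nonneg)
    then have "Re (det M) / b ^ (CARD('n) - 1) * (norm x)\<^sup>2
        = (\<Sum>i\<in>UNIV. Re (det M) / b ^ (CARD('n) - 1) * (norm ((conj_transpose U *v x) $ i))\<^sup>2)"
      by (simp only: sum_distrib_left)
    also have "\<dots> \<le> (\<Sum>i\<in>UNIV. s $ i * (norm ((conj_transpose U *v x) $ i))\<^sup>2)"
      by (intro sum_mono mult_right_mono low zero_le_power2)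
    also have "\<dots> = inner x (M *v x)" by (simp only: M' unitary_diag_form)
    finally show ?thesis .
  qed
  then show ?thesis using M by (simp add: lower_bounded_def pos_def_iff)
qed

lemma lower_bounded_norm_vector:
  assumes "lower_bounded a M"
  shows "a * norm x \<le> norm (M *v x)"
proof (cases "x = 0")
  case False
  have "a * (norm x)\<^sup>2 \<le> inner x (M *v x)" using assms by (simp add: lower_bounded_def)
  also have "\<dots> \<le> norm x * norm (M *v x)" by (rule norm_cauchy_schwarz)
  finally show ?thesis using False by (simp add: power2_eq_square mult.left_commute)
qed simp

lemma lower_bounded_inner_mult_left:
  assumes "lower_bounded a M"
  shows "a * (norm Z)\<^sup>2 \<le> inner Z (M ** Z)"
  using assms unfolding norm_columns inner_columns sum_distrib_left column_mult
  by (intro sum_mono) (simp add: lower_bounded_def)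

lemma lower_bounded_inner_mult_right:
  assumes "lower_bounded a M"
  shows "a * (norm Z)\<^sup>2 \<le> inner Z (Z ** M)"
  using lower_bounded_inner_mult_left[OF assms, of "conj_transpose Z"] assms inner_conj_transpose[of Z "Z ** M"]
  by (simp add: conj_transpose_mult lower_bounded_def hermitian_def)

lemma lower_bounded_norm_mult:
  assumes "lower_bounded a M" "0 \<le> a"
  shows "a * norm Z \<le> norm (M ** Z)"
proof -
  have "(a * norm Z)\<^sup>2 \<le> (norm (M ** Z))\<^sup>2"
    unfolding power_mult_distrib norm_columns sum_distrib_left column_mult
    using lower_bounded_norm_vector[OF assms(1)] assms(2)
    by (intro sum_mono) (metis norm_ge_zero mult_nonneg_nonneg power_mono power_mult_distrib)
  then show ?thesis by (rule power2_le_imp_le) simp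
qed

lemma matrix_inv_norm_le_left:
  assumes "lower_bounded a M" "0 < a"
  shows "a * norm (matrix_inv M ** Z) \<le> norm Z"
  using lower_bounded_norm_mult[OF assms(1), of "matrix_inv M ** Z"] assms(2)
    pos_def_matrix_inv(1)[OF lower_bounded_pos_def[OF assms]]
  by (simp add: matrix_mul_assoc)

lemma matrix_inv_norm_le_right:
  assumes "lower_bounded a M" "0 < a"
  shows "a * norm (Z ** matrix_inv M) \<le> norm Z"
  using matrix_inv_norm_le_left[OF assms, of "conj_transpose Z"] norm_conj_transpose[of "Z ** matrix_inv M"]
    pos_def_matrix_inv(3)[OF lower_bounded_pos_def[OF assms]]
  by (simp add: conj_transpose_mult pos_def_iff hermitian_def)

lemma norm_matrix_mult_le: "norm (M ** N) \<le> norm M * norm N" for M :: "complex^'n^'m" and N :: "complex^'p^'n"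
proof -
  have "(norm (M ** N))\<^sup>2 \<le> (norm M * norm N)\<^sup>2"
    unfolding power_mult_distrib norm_columns[of "M ** N"] norm_columns[of N] sum_distrib_left column_mult
    using norm_matrix_vector_le[of M]
    by (intro sum_mono) (metis norm_ge_zero power_mono power_mult_distrib)
  then show ?thesis by (rule power2_le_imp_le) simp
qed

lemma pos_def_norm_le_trace: "pos_def X \<Longrightarrow> norm X \<le> Re (trace X)"
proof -
  assume "pos_def X"
  then obtain S where S: "hermitian S" "S ** S = X" using pos_def_sqrt by metis
  have "norm X \<le> norm S * norm S" using norm_matrix_mult_le[of S S] S by simp
  also have "\<dots> = inner S S" by (simp add: power2_norm_eq_inner flip: power2_eq_square)
  also have "\<dots> = Re (trace X)" using S by (simp add: inner_eq_trace hermitian_def)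
  finally show ?thesis .
qed

lemma pos_def_inner_nonneg:
  assumes "pos_def P" "pos_def Q"
  shows "0 \<le> inner P Q"
proof -
  obtain S where S: "hermitian S" "S ** S = P" using pos_def_sqrt[OF assms(1)] by metis
  have "0 \<le> inner S (Q ** S)"
    using lower_bounded_inner_mult_left[OF pos_def_lower_bounded[OF assms(2)], of S] by simp
  also have "\<dots> = inner P Q"
    using S inner_mult_right[of S S Q] by (simp add: hermitian_def)
  finally show ?thesis .
qed

section \<open>Saturation as a projection\<close>

lemma unitary_diag_inner:
  "inner (U ** real_diag d ** conj_transpose U) W
    = (\<Sum>j\<in>UNIV. d $ j * inner (column j U) (W *v column j U))"
proof -
  have col: "column j (U ** real_diag d) = d $ j *\<^sub>R column j U" for j
    by (simp add: vec_eq_iff column_def matrix_matrix_mult_def real_diag_def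
      if_distrib[where f="\<lambda>a. _ * a"] scaleR_conv_of_real[where 'a=complex] mult.commute cong: if_cong)
  have "inner (U ** real_diag d ** conj_transpose U) W = inner (U ** real_diag d) (W ** U)"
    using inner_mult_right[of "U ** real_diag d" "conj_transpose U" W] by simp
  also have "\<dots> = (\<Sum>j\<in>UNIV. inner (d $ j *\<^sub>R column j U) (W *v column j U))"
    by (simp only: inner_columns[of "U ** real_diag d"] col column_mult[of _ W])
  finally show ?thesis by simp
qed

text \<open>The last part is the variational inequality that characterizes the projection onto the
  spectral norm ball. In the eigenbasis of \<open>M\<close> only the diagonal entries of
  \<open>Z\<close> matter, and these have modulus at most \<open>\<gamma>\<close>, so that the
  inequality reduces to that of the scalar projection onto \<open>[-\<gamma>, \<gamma>]\<close>. It
  holds for whichever decomposition the choice operator in the definition selects.\<close>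

lemma saturation_projection:
  fixes M :: "complex^'n^'n"
  assumes M: "hermitian M" and g: "0 < \<gamma>"
  shows "hermitian (saturation \<gamma> M)" "spectral_norm (saturation \<gamma> M) \<le> \<gamma>"
    "\<And>Z. spectral_norm Z \<le> \<gamma> \<Longrightarrow> inner (M - saturation \<gamma> M) (Z - saturation \<gamma> M) \<le> 0"
proof -
  let ?clip = "\<lambda>s::real^'n. \<chi> i. min (max (s $ i) (- \<gamma>)) \<gamma>"
  have "\<exists>T U s. unitary U \<and> M = U ** real_diag s ** conj_transpose U \<and>
      T = U ** real_diag (?clip s) ** conj_transpose U"
    using spectral_theorem[OF M] by metis
  then have "\<exists>U s. unitary U \<and> M = U ** real_diag s ** conj_transpose U \<and>
      saturation \<gamma> M = U ** real_diag (?clip s) ** conj_transpose U"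
    unfolding saturation_def by (rule someI_ex)
  then obtain U s where U: "unitary U" and M': "M = U ** real_diag s ** conj_transpose U"
    and T: "saturation \<gamma> M = U ** real_diag (?clip s) ** conj_transpose U" by blast
  define c where "c = ?clip s"
  have T: "saturation \<gamma> M = U ** real_diag c ** conj_transpose U" using T by (simp add: c_def)
  have c: "\<bar>c $ i\<bar> \<le> \<gamma>" for i using g by (auto simp: c_def)
  show "hermitian (saturation \<gamma> M)" by (simp add: T hermitian_unitary_diag)
  have "norm (saturation \<gamma> M *v x) \<le> \<gamma> * norm x" for x
  proof -
    have "(norm (saturation \<gamma> M *v x))\<^sup>2 = inner x ((U ** real_diag (\<chi> i. c $ i * c $ i) ** conj_transpose U) *v x)"
      using hermitian_unitary_diag[of U c]
      by (simp add: power2_norm_eq_inner T hermitian_def matrix_vector_mul_assoc unitary_diag_mult[OF U]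
        inner_matrix_vector_left[of _ x])
    also have "\<dots> = (\<Sum>i\<in>UNIV. (c $ i)\<^sup>2 * (norm ((conj_transpose U *v x) $ i))\<^sup>2)"
      by (simp add: unitary_diag_form power2_eq_square)
    also have "\<dots> \<le> (\<Sum>i\<in>UNIV. \<gamma>\<^sup>2 * (norm ((conj_transpose U *v x) $ i))\<^sup>2)"
      using c g by (intro sum_mono mult_right_mono) (auto simp: abs_le_square_iff[symmetric])
    also have "\<dots> = \<gamma>\<^sup>2 * (norm (conj_transpose U *v x))\<^sup>2"
      by (simp add: norm_vec_def[of "conj_transpose U *v x"] L2_set_def sum_nonneg sum_distrib_left)
    also have "\<dots> = (\<gamma> * norm x)\<^sup>2" by (simp add: unitary_norm[OF U] power_mult_distrib)
    finally show ?thesis by (rule power2_le_imp_le) (use g in simp)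
  qed
  then show "spectral_norm (saturation \<gamma> M) \<le> \<gamma>" by (rule spectral_norm_leI)
  show "inner (M - saturation \<gamma> M) (Z - saturation \<gamma> M) \<le> 0" if Z: "spectral_norm Z \<le> \<gamma>" for Z
  proof -
    have "real_diag s - real_diag c = real_diag (s - c)"
      by (simp add: vec_eq_iff real_diag_def)
    then have "M - saturation \<gamma> M = U ** real_diag (s - c) ** conj_transpose U"
      by (simp only: T) (simp add: M' flip: matrix_mult_diff_left matrix_mult_diff_right)
    then have "inner (M - saturation \<gamma> M) (Z - saturation \<gamma> M)
      = (\<Sum>j\<in>UNIV. (s - c) $ j * (inner (column j U) (Z *v column j U) - c $ j))"
      by (simp only: unitary_diag_inner) (simp only: T matrix_vector_mult_diff_rdistrib inner_diff_right
        unitary_diag_eigenvalue[OF U])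
    also have "\<dots> \<le> 0"
    proof (rule sum_nonpos)
      fix j
      have "\<bar>inner (column j U) (Z *v column j U)\<bar> \<le> norm (Z *v column j U)"
        using Cauchy_Schwarz_ineq2[of "column j U" "Z *v column j U"] by (simp add: unitary_column[OF U])
      also have "\<dots> \<le> \<gamma>"
        using spectral_norm_bound[of Z "column j U"] Z by (simp add: unitary_column[OF U])
      finally have z: "\<bar>inner (column j U) (Z *v column j U)\<bar> \<le> \<gamma>" .
      consider "s $ j > \<gamma>" | "s $ j < - \<gamma>" | "c $ j = s $ j"
        unfolding c_def by (cases "s $ j > \<gamma>"; cases "s $ j < - \<gamma>") (auto simp: not_less)
      then show "(s - c) $ j * (inner (column j U) (Z *v column j U) - c $ j) \<le> 0"
      proof cases
        case 1
        then have "c $ j = \<gamma>" using g by (simp add: c_def)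
        then show ?thesis using z 1 by (intro mult_nonneg_nonpos) auto
      next
        case 2
        then have "c $ j = - \<gamma>" using g by (simp add: c_def)
        then show ?thesis using z 2 by (intro mult_nonpos_nonneg) auto
      qed simp
    qed
    finally show ?thesis .
  qed
qed

section \<open>The operators and the dual gradient\<close>

lemma inner_elementwise:
  fixes E :: "complex^'p^'p"
  assumes "\<And>i j. E $ i $ j \<in> {0, 1}"
  shows "inner (Z * E) Y = inner Z (E * Y)"
proof -
  have "inner ((Z * E) $ i $ j) (Y $ i $ j) = inner (Z $ i $ j) ((E * Y) $ i $ j)" for i j
    using assms[of i j] by auto
  then show ?thesis by (simp add: inner_vec_def)
qed

lemma opA1_adjoint: "inner (opA1 A X) Y = inner X (opA1_adj A Y)"
  by (simp add: opA1_def opA1_adj_def inner_add_left inner_add_right inner_mult_left[of A] inner_mult_right[of X])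

lemma opA2_adjoint:
  assumes "\<And>i j. E $ i $ j \<in> {0, 1}"
  shows "inner (opA2 C E X) Y = inner X (opA2_adj C E Y)"
proof -
  have "inner (opA2 C E X) Y = inner (C ** X ** conj_transpose C) (E * Y)"
    by (simp add: opA2_def inner_elementwise[OF assms])
  also have "\<dots> = inner (C ** X) ((E * Y) ** C)"
    using inner_mult_right[of "C ** X" "conj_transpose C"] by simp
  finally show ?thesis by (simp add: inner_mult_left opA2_adj_def matrix_mul_assoc)
qed

lemma opA_adjoint:
  assumes "\<And>i j. E $ i $ j \<in> {0, 1}"
  shows "inner (opA A C E X) Y = inner X (opA_adj A C E Y)"
  by (simp add: opA_def opA_adj_def inner_prod_def opA1_adjoint opA2_adjoint[OF assms] inner_add_right)

lemma elementwise_scaleR: "(r *\<^sub>R M) * (E::complex^'p^'q) = r *\<^sub>R (M * E)" "E * (r *\<^sub>R M) = r *\<^sub>R (E * M)"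
  by (simp_all add: vec_eq_iff)

lemma bounded_linear_opA1_adj: "bounded_linear (opA1_adj A)"
  unfolding linear_conv_bounded_linear[symmetric]
  by (rule linearI) (simp_all add: opA1_adj_def matrix_add_ldistrib matrix_mult_add_left
      matrix_mult_scaleR_left matrix_mult_scaleR_right scaleR_add_right)

lemma bounded_linear_opA_adj: "bounded_linear (opA_adj A C E)"
  unfolding linear_conv_bounded_linear[symmetric]
  by (rule linearI) (simp_all add: opA_adj_def opA2_adj_def opA1_adj_def matrix_add_ldistrib matrix_mult_add_left
      matrix_mult_scaleR_left matrix_mult_scaleR_right scaleR_add_right distrib_left distrib_right elementwise_scaleR)

lemma bounded_linear_opA: "bounded_linear (opA A C E)"
  unfolding linear_conv_bounded_linear[symmetric]
  by (rule linearI) (simp_all add: opA_def opA2_def opA1_def matrix_add_ldistrib matrix_mult_add_left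
      matrix_mult_scaleR_left matrix_mult_scaleR_right scaleR_add_right distrib_left distrib_right elementwise_scaleR)

lemma hermitian_elementwise:
  assumes "transpose E = E" "\<And>i j. E $ i $ j \<in> {0, 1}" "hermitian Y"
  shows "hermitian (E * Y)" "hermitian (Y * E)"
proof -
  have "cnj (E $ j $ i) = E $ i $ j" for i j
    using assms(1) assms(2)[of i j] by (auto simp: vec_eq_iff transpose_def)
  then show "hermitian (E * Y)" "hermitian (Y * E)"
    using assms(3) by (simp_all add: hermitian_def vec_eq_iff)
qed

lemma hermitian_opA_adj:
  assumes "transpose E = E" "\<And>i j. E $ i $ j \<in> {0, 1}" "hermitian (fst Y)" "hermitian (snd Y)"
  shows "hermitian (opA_adj A C E Y)"
  using hermitian_elementwise(1)[OF assms(1,2,4)] assms(3)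
  by (simp add: hermitian_def opA_adj_def opA1_adj_def opA2_adj_def conj_transpose_add conj_transpose_mult matrix_mul_assoc)

lemma hermitian_opA1: "hermitian X \<Longrightarrow> hermitian (opA1 A X)"
  by (simp add: hermitian_def opA1_def conj_transpose_add conj_transpose_mult)

lemma hermitian_opA2:
  assumes "transpose E = E" "\<And>i j. E $ i $ j \<in> {0, 1}" "hermitian X"
  shows "hermitian (opA2 C E X)"
  unfolding opA2_def using assms(3)
  by (intro hermitian_elementwise assms) (simp add: hermitian_def conj_transpose_mult matrix_mul_assoc)

definition dual_gradient ::
  "complex^'n^'n \<Rightarrow> complex^'n^'p \<Rightarrow> complex^'p^'p \<Rightarrow> complex^'p^'p
    \<Rightarrow> (complex^'n^'n) \<times> (complex^'p^'p) \<Rightarrow> (complex^'n^'n) \<times> (complex^'p^'p)" where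
  "dual_gradient A C E G Y = opA A C E (matrix_inv (opA_adj A C E Y)) - (0, G)"

lemma ama_update_eq:
  "ama_update A C E G \<gamma> \<rho> Y =
    (saturation \<gamma> (fst (Y + \<rho> *\<^sub>R dual_gradient A C E G Y)), snd (Y + \<rho> *\<^sub>R dual_gradient A C E G Y))"
  by (simp add: ama_update_def dual_gradient_def opA_def Let_def)

lemma dual_gradient_inner:
  assumes "\<And>i j. E $ i $ j \<in> {0, 1}"
  shows "inner (dual_gradient A C E G Y) D
    = inner (matrix_inv (opA_adj A C E Y)) (opA_adj A C E D) - inner G (snd D)"
  by (simp add: dual_gradient_def inner_diff_left opA_adjoint[OF assms]) (simp add: inner_prod_def)

lemma dual_objective_concave:
  assumes "\<And>i j. E $ i $ j \<in> {0, 1}" "pos_def (opA_adj A C E Y)" "pos_def (opA_adj A C E Z)"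
  shows "dual_objective A C E G Z - dual_objective A C E G Y \<le> inner (dual_gradient A C E G Y) (Z - Y)"
  using log_det_concave[OF assms(2,3)]
  by (simp add: dual_gradient_inner[OF assms(1)] dual_objective_def trace_inner_eq_inner
      linear_diff[OF bounded_linear.linear[OF bounded_linear_opA_adj]] inner_diff_right)

lemma ama_update_projection:
  fixes Y :: "(complex^'n^'n) \<times> (complex^'p^'p)" and \<rho> :: real
  assumes E: "transpose E = E" "\<And>i j. E $ i $ j \<in> {0, 1}" and "hermitian G" and g: "0 < \<gamma>"
    and Y: "hermitian (fst Y)" "hermitian (snd Y)" "pos_def (opA_adj A C E Y)"
  defines "Y' \<equiv> ama_update A C E G \<gamma> \<rho> Y"
  shows "hermitian (fst Y')" "hermitian (snd Y')" "spectral_norm (fst Y') \<le> \<gamma>"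
    "\<And>Z. spectral_norm (fst Z) \<le> \<gamma> \<Longrightarrow> inner (Y + \<rho> *\<^sub>R dual_gradient A C E G Y - Y') (Z - Y') \<le> 0"
proof -
  let ?V = "Y + \<rho> *\<^sub>R dual_gradient A C E G Y"
  have X: "hermitian (matrix_inv (opA_adj A C E Y))"
    using pos_def_matrix_inv(3)[OF Y(3)] by (simp add: pos_def_iff)
  have V: "hermitian (fst ?V)" "hermitian (snd ?V)"
    using hermitian_opA1[OF X, of A] hermitian_opA2[OF E X, of C] Y \<open>hermitian G\<close>
    by (simp_all add: dual_gradient_def opA_def hermitian_def conj_transpose_add conj_transpose_scaleR conj_transpose_diff)
  have Y': "Y' = (saturation \<gamma> (fst ?V), snd ?V)"
    by (simp add: Y'_def ama_update_eq)
  note sat = saturation_projection[OF V(1) g]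
  show "hermitian (fst Y')" "hermitian (snd Y')" "spectral_norm (fst Y') \<le> \<gamma>"
    using sat(1,2) V(2) by (simp_all add: Y')
  show "inner (?V - Y') (Z - Y') \<le> 0" if "spectral_norm (fst Z) \<le> \<gamma>" for Z
    using sat(3)[OF that] by (simp add: Y' inner_prod_def)
qed

section \<open>Nonexpansiveness of the iteration\<close>

lemma variational_nonexpansive:
  fixes p q u v :: "'a::real_inner"
  assumes "inner (u - p) (q - p) \<le> 0" "inner (v - q) (p - q) \<le> 0"
  shows "norm (p - q) \<le> norm (u - v)"
proof (cases "p = q")
  case False
  have "(norm (p - q))\<^sup>2 \<le> inner (u - v) (p - q)"
    using assms by (simp add: power2_norm_eq_inner inner_diff_left inner_diff_right inner_commute)
  also have "\<dots> \<le> norm (u - v) * norm (p - q)" by (rule norm_cauchy_schwarz)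
  finally show ?thesis using False by (simp add: power2_eq_square)
qed simp

lemma matrix_inv_diff:
  assumes "pos_def P" "pos_def Q"
  shows "matrix_inv Q - matrix_inv P = matrix_inv P ** (P - Q) ** matrix_inv Q"
  using pos_def_matrix_inv[OF assms(1)] pos_def_matrix_inv[OF assms(2)]
  by (simp add: matrix_mult_diff_left matrix_mult_diff_right)
    (metis matrix_mul_assoc matrix_mul_rid)

text \<open>With \<open>W = Q\<^sup>-\<^sup>1 - P\<^sup>-\<^sup>1\<close> one has \<open>P - Q = P W
  Q\<close>. Splitting \<open>P = S S\<close> gives \<open>\<langle>W, P W Q\<rangle> = \<langle>S
  W, (S W) Q\<rangle> \<ge> a \<parallel>S W\<parallel>\<^sup>2 = a \<langle>W, P W\<rangle> \<ge>
  a\<^sup>2 \<parallel>W\<parallel>\<^sup>2\<close>.\<close>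

lemma matrix_inv_strongly_monotone:
  fixes P Q :: "complex^'n^'n"
  assumes P: "lower_bounded a P" and Q: "lower_bounded a Q" and a: "0 < a"
  shows "a\<^sup>2 * (norm (matrix_inv Q - matrix_inv P))\<^sup>2 \<le> inner (matrix_inv Q - matrix_inv P) (P - Q)"
proof -
  let ?W = "matrix_inv Q - matrix_inv P"
  have pd: "pos_def P" "pos_def Q" using lower_bounded_pos_def a P Q by blast+
  obtain S where S: "hermitian S" "S ** S = P" using pos_def_sqrt[OF pd(1)] by metis
  have W: "P ** ?W ** Q = P - Q"
    using pos_def_matrix_inv[OF pd(1)] pos_def_matrix_inv[OF pd(2)]
    by (simp add: matrix_mult_diff_left matrix_mult_diff_right flip: matrix_mul_assoc)
  have "a\<^sup>2 * (norm ?W)\<^sup>2 \<le> a * inner ?W (P ** ?W)"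
    using lower_bounded_inner_mult_left[OF P, of ?W] a by (simp add: power2_eq_square mult.assoc)
  also have "inner ?W (P ** ?W) = (norm (S ** ?W))\<^sup>2"
    using S by (simp add: power2_norm_eq_inner inner_mult_left hermitian_def matrix_mul_assoc)
  also have "a * (norm (S ** ?W))\<^sup>2 \<le> inner (S ** ?W) (S ** ?W ** Q)"
    by (rule lower_bounded_inner_mult_right[OF Q])
  also have "\<dots> = inner ?W (P - Q)"
    using S W by (simp add: inner_mult_left hermitian_def matrix_mul_assoc)
  finally show ?thesis by simp
qed

text \<open>The gradient is cocoercive: its difference is \<open>\<A>(W)\<close> for the difference
  \<open>W\<close> of the inverses, and strong monotonicity of the inverse controls
  \<open>\<parallel>W\<parallel>\<^sup>2\<close> by the inner product of that difference with
  \<open>Y - Z\<close>.\<close>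

lemma gradient_step_nonexpansive:
  assumes E: "\<And>i j. E $ i $ j \<in> {0, 1}" and a: "0 < a" and "0 \<le> \<rho>"
    and Y: "lower_bounded a (opA_adj A C E Y)" and Z: "lower_bounded a (opA_adj A C E Z)"
    and rho: "\<rho> * (sigma_max (opA A C E))\<^sup>2 \<le> 2 * a\<^sup>2"
  shows "norm ((Y + \<rho> *\<^sub>R dual_gradient A C E G Y) - (Z + \<rho> *\<^sub>R dual_gradient A C E G Z)) \<le> norm (Y - Z)"
proof -
  let ?P = "opA_adj A C E Y" and ?Q = "opA_adj A C E Z"
  let ?W = "matrix_inv ?Q - matrix_inv ?P"
  let ?g = "dual_gradient A C E G Z - dual_gradient A C E G Y"
  have g: "?g = opA A C E ?W"
    by (simp add: dual_gradient_def linear_diff[OF bounded_linear.linear[OF bounded_linear_opA]])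
  have "\<rho> * (norm ?g)\<^sup>2 \<le> \<rho> * (sigma_max (opA A C E) * norm ?W)\<^sup>2"
    unfolding g sigma_max_def using \<open>0 \<le> \<rho>\<close>
    by (intro mult_left_mono power_mono onorm[OF bounded_linear_opA]) auto
  also have "\<dots> \<le> 2 * a\<^sup>2 * (norm ?W)\<^sup>2"
    using mult_right_mono[OF rho, of "(norm ?W)\<^sup>2"] by (simp add: power_mult_distrib mult.assoc)
  also have "\<dots> \<le> 2 * inner ?W (?P - ?Q)"
    using matrix_inv_strongly_monotone[OF Y Z a] by simp
  also have "inner ?W (?P - ?Q) = inner ?g (Y - Z)"
    by (simp add: g opA_adjoint[OF E] linear_diff[OF bounded_linear.linear[OF bounded_linear_opA_adj]])
  finally have *: "\<rho> * (norm ?g)\<^sup>2 \<le> 2 * inner ?g (Y - Z)" .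
  have "(norm ((Y + \<rho> *\<^sub>R dual_gradient A C E G Y) - (Z + \<rho> *\<^sub>R dual_gradient A C E G Z)))\<^sup>2
      = (norm ((Y - Z) - \<rho> *\<^sub>R ?g))\<^sup>2"
    by (simp add: algebra_simps)
  also have "\<dots> = (norm (Y - Z))\<^sup>2 + \<rho> * (\<rho> * (norm ?g)\<^sup>2 - 2 * inner ?g (Y - Z))"
    unfolding power2_norm_eq_inner inner_diff_left[of "Y - Z"] inner_diff_right[of _ "Y - Z"]
    by (simp only: inner_scaleR_left inner_scaleR_right inner_diff_left[of "\<rho> *\<^sub>R _"]
      inner_diff_right[of "\<rho> *\<^sub>R _"] inner_commute[of "Y - Z" ?g]) (simp add: algebra_simps)
  also have "\<dots> \<le> (norm (Y - Z))\<^sup>2"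
    using mult_left_mono[OF * \<open>0 \<le> \<rho>\<close>] by (simp add: algebra_simps)
  finally show ?thesis by (rule power2_le_imp_le) simp
qed

section \<open>Quadratic lower estimate of the log-determinant\<close>

lemma lower_bounded_segment:
  assumes "lower_bounded a P" "lower_bounded a (P + D)" "0 \<le> t" "t \<le> 1"
  shows "lower_bounded a (P + t *\<^sub>R D)"
proof -
  have h: "hermitian P" "hermitian (P + D)" using assms by (auto simp: lower_bounded_def)
  then have "hermitian (P + t *\<^sub>R D)"
    by (simp add: hermitian_def conj_transpose_add conj_transpose_scaleR)
  moreover have "a * (norm x)\<^sup>2 \<le> inner x ((P + t *\<^sub>R D) *v x)" for x
  proof -
    have "(1 - t) * (a * (norm x)\<^sup>2) + t * (a * (norm x)\<^sup>2)
        \<le> (1 - t) * inner x (P *v x) + t * inner x ((P + D) *v x)"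
      using assms by (intro add_mono mult_left_mono) (auto simp: lower_bounded_def)
    then show ?thesis
      by (simp add: matrix_vector_mult_add_rdistrib complex_matrix_scaleR_vector inner_add_right algebra_simps)
  qed
  ultimately show ?thesis by (simp add: lower_bounded_def)
qed

lemma matrix_inv_lipschitz:
  assumes P: "lower_bounded a P" and Q: "lower_bounded a Q" and a: "0 < a"
  shows "norm (matrix_inv P - matrix_inv Q) \<le> norm (P - Q) / a\<^sup>2"
proof -
  have pd: "pos_def P" "pos_def Q" using lower_bounded_pos_def a P Q by blast+
  have "a * (a * norm (matrix_inv P - matrix_inv Q)) \<le> a * norm (matrix_inv P ** (P - Q))"
    using matrix_inv_norm_le_right[OF Q a, of "matrix_inv P ** (P - Q)"] matrix_inv_diff[OF pd] a
    by (simp add: norm_minus_commute[of "matrix_inv P"])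
  also have "\<dots> \<le> norm (P - Q)" by (rule matrix_inv_norm_le_left[OF P a])
  finally show ?thesis using a by (simp add: field_simps power2_eq_square)
qed

text \<open>Concavity at the midpoint and at the endpoint bounds the increment from below by half
  the slope at each of the two. By the Lipschitz bound for the inverse these slopes fall short of
  the initial one by at most \<open>1/2\<close> and \<open>1\<close> times
  \<open>\<parallel>D\<parallel>\<^sup>2 / a\<^sup>2\<close>, which averages to
  \<open>3/4\<close>.\<close>

lemma log_det_lower_estimate:
  fixes P D :: "complex^'n^'n"
  assumes P: "lower_bounded a P" and PD: "lower_bounded a (P + D)" and a: "0 < a"
  shows "inner (matrix_inv P) D - 3/4 * ((norm D)\<^sup>2 / a\<^sup>2) \<le> ln (Re (det (P + D))) - ln (Re (det P))"
proof -
  let ?M = "P + (1/2) *\<^sub>R D"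
  have M: "lower_bounded a ?M" by (rule lower_bounded_segment[OF P PD]) auto
  note pd = lower_bounded_pos_def[OF _ a]
  have slope: "inner (matrix_inv P) D - t * ((norm D)\<^sup>2 / a\<^sup>2) \<le> inner (matrix_inv (P + t *\<^sub>R D)) D"
    if "lower_bounded a (P + t *\<^sub>R D)" "0 \<le> t" for t
  proof -
    have "inner (matrix_inv P - matrix_inv (P + t *\<^sub>R D)) D \<le> norm (matrix_inv P - matrix_inv (P + t *\<^sub>R D)) * norm D"
      by (rule norm_cauchy_schwarz)
    also have "\<dots> \<le> norm (P - (P + t *\<^sub>R D)) / a\<^sup>2 * norm D"
      by (intro mult_right_mono matrix_inv_lipschitz P that a) auto
    also have "\<dots> = t * ((norm D)\<^sup>2 / a\<^sup>2)" using that(2) by (simp add: power2_eq_square)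
    finally show ?thesis by (simp add: inner_diff_left)
  qed
  have "ln (Re (det P)) - ln (Re (det ?M)) \<le> - (1/2) * inner (matrix_inv ?M) D"
    using log_det_concave[OF pd[OF M] pd[OF P]] by simp
  moreover have "ln (Re (det ?M)) - ln (Re (det (P + D))) \<le> - (1/2) * inner (matrix_inv (P + D)) D"
  proof -
    have "?M - (P + D) = - (1/2) *\<^sub>R D" by (simp add: algebra_simps flip: scaleR_add_left)
    then show ?thesis using log_det_concave[OF pd[OF PD] pd[OF M]] by (simp only: inner_scaleR_right)
  qed
  moreover note slope[of "1/2"] slope[of 1]
  ultimately show ?thesis using M PD by simp
qed

lemma lower_bounded_perturb:
  assumes "lower_bounded a P" "hermitian D" "norm D \<le> e"
  shows "lower_bounded (a - e) (P + D)"
proof -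
  have "(a - e) * (norm x)\<^sup>2 \<le> inner x ((P + D) *v x)" for x
  proof -
    have "\<bar>inner x (D *v x)\<bar> \<le> norm x * norm (D *v x)" by (rule Cauchy_Schwarz_ineq2)
    also have "\<dots> \<le> norm x * (e * norm x)"
      using order_trans[OF norm_matrix_vector_le mult_right_mono[OF assms(3)]] by (intro mult_left_mono) auto
    finally show ?thesis using assms(1)
      by (simp add: lower_bounded_def matrix_vector_mult_add_rdistrib inner_add_right algebra_simps power2_eq_square)
        (smt (verit))
  qed
  then show ?thesis using assms(1,2)
    by (simp add: lower_bounded_def hermitian_def conj_transpose_add)
qed

text \<open>The bound \<open>a\<close> holds on a superlevel set, whereas the ascent estimate that
  keeps the segment in this set needs such a bound to start with. The circle is broken by moving in
  steps so short that at most a tenth of \<open>a\<close> is lost in one of them: the weaker bound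
  \<open>9/10 a\<close> still yields ascent, and ascent restores \<open>a\<close>. In the
  application \<open>g\<close> is the slope of the linear term that the dual objective subtracts
  from \<open>log det\<close>.\<close>

lemma lower_bound_propagates:
  fixes P D :: "complex^'n^'n"
  assumes P: "lower_bounded a P" and a: "0 < a" and D: "hermitian D"
    and slope: "(norm D)\<^sup>2 / a\<^sup>2 \<le> inner (matrix_inv P) D - g"
    and level: "\<And>s. 0 \<le> s \<Longrightarrow> s \<le> 1 \<Longrightarrow> pos_def (P + s *\<^sub>R D) \<Longrightarrow>
      ln (Re (det P)) + s * g \<le> ln (Re (det (P + s *\<^sub>R D))) \<Longrightarrow> lower_bounded a (P + s *\<^sub>R D)"
  shows "lower_bounded a (P + D)"
proof -
  obtain N :: nat where "10 * norm D / a < N" using reals_Archimedean2 by blast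
  moreover from this have "0 < real N" using a by (meson divide_nonneg_pos le_less_trans mult_nonneg_nonneg norm_ge_zero zero_le_numeral)
  ultimately have N: "0 < N" "norm D / N \<le> a / 10"
    using a by (simp_all add: field_simps)
  have "lower_bounded a (P + (real j / N) *\<^sub>R D)" if "j \<le> N" for j
    using that
  proof (induction j)
    case (Suc j)
    define s where "s = real (Suc j) / N"
    have s: "0 \<le> s" "s \<le> 1" using Suc.prems N by (auto simp: s_def)
    have "lower_bounded (a - a / 10) (P + (real j / N) *\<^sub>R D + (1 / N) *\<^sub>R D)"
      using Suc D N
      by (intro lower_bounded_perturb) (auto simp: hermitian_def conj_transpose_scaleR)
    moreover have "P + (real j / N) *\<^sub>R D + (1 / N) *\<^sub>R D = P + s *\<^sub>R D"
      by (simp add: s_def add_divide_distrib scaleR_add_left)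
    ultimately have low: "lower_bounded (9/10 * a) (P + s *\<^sub>R D)" by simp
    have "inner (matrix_inv P) (s *\<^sub>R D) - 3/4 * ((norm (s *\<^sub>R D))\<^sup>2 / (9/10 * a)\<^sup>2)
        \<le> ln (Re (det (P + s *\<^sub>R D))) - ln (Re (det P))"
      using lower_bounded_mono[OF P] low a by (intro log_det_lower_estimate) auto
    \<comment> \<open>The slack between 3/4 and 1 absorbs the loss: \<open>(3/4) / (9/10)\<^sup>2 = 75/81\<close>.\<close>
    moreover have "3/4 * ((norm (s *\<^sub>R D))\<^sup>2 / (9/10 * a)\<^sup>2) \<le> s * ((norm D)\<^sup>2 / a\<^sup>2)"
    proof -
      have "3/4 * ((norm (s *\<^sub>R D))\<^sup>2 / (9/10 * a)\<^sup>2) = (75/81) * s\<^sup>2 * ((norm D)\<^sup>2 / a\<^sup>2)"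
        using a by (simp add: power_mult_distrib power_divide field_simps)
      also have "\<dots> \<le> s * ((norm D)\<^sup>2 / a\<^sup>2)"
        using s mult_mono[of s 1 s s] by (intro mult_right_mono) (auto simp: power2_eq_square)
      finally show ?thesis .
    qed
    moreover have "s * ((norm D)\<^sup>2 / a\<^sup>2) \<le> s * inner (matrix_inv P) D - s * g"
      using mult_left_mono[OF slope s(1)] by (simp add: algebra_simps)
    ultimately have "ln (Re (det P)) + s * g \<le> ln (Re (det (P + s *\<^sub>R D)))" by simp
    then have "lower_bounded a (P + s *\<^sub>R D)"
      using lower_bounded_pos_def[OF low] a by (intro level s) auto
    then show ?case by (simp add: s_def)
  qed (use P in simp)
  from this[of N] N show ?thesis by simp
qed

section \<open>Convergence of the alternating minimization algorithm\<close>

lemma telescoping_rate: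
  fixes d r :: "nat \<Rightarrow> real"
  assumes "\<And>k. 0 \<le> r k" "\<And>k. d (Suc k) \<le> d k" "\<And>k. 0 \<le> d k"
    and "\<And>k. d (Suc k) \<le> (r k - r (Suc k)) + (d k - d (Suc k))" and "1 \<le> k"
  shows "d k \<le> (r 0 + d 0) / k"
proof -
  have "real k * d k \<le> r 0 - r k + (d 0 - d k)" for k
  proof (induction k)
    case (Suc k)
    have "real k * d (Suc k) \<le> real k * d k" using assms(2) by (intro mult_left_mono) auto
    then show ?case using Suc assms(4)[of k] by (simp add: algebra_simps)
  qed simp
  from this[of k] have "real k * d k \<le> r 0 + d 0" using assms(1)[of k] assms(3)[of k] by simp
  then show ?thesis using \<open>1 \<le> k\<close> by (simp add: field_simps)
qed

text \<open>Since \<open>G = \<A>\<^sub>2(X)\<close>, the linear term is \<open>\<langle>G,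
  Y\<^sub>2\<rangle> = \<langle>X, \<A>\<^sup>\<dagger>(Y)\<rangle> - \<langle>X,
  \<A>\<^sub>1\<^sup>\<dagger>(Y\<^sub>1)\<rangle>\<close>. The first summand is nonnegative and the
  second is bounded on the spectral norm ball, so that a lower bound on the objective bounds the
  determinant from below. The distance to \<open>Ybar\<close> bounds the spectrum from
  above.\<close>

lemma level_set_lower_bounded:
  fixes A :: "complex^'n^'n" and C :: "complex^'n^'p" and G E :: "complex^'p^'p"
    and Y Y0 Ybar :: "(complex^'n^'n) \<times> (complex^'p^'p)"
  assumes E: "\<And>i j. E $ i $ j \<in> {0, 1}"
    and X: "pos_def X" "opA2 C E X = G"
    and bar: "pos_def (opA_adj A C E Ybar)"
    and Y0: "pos_def (opA_adj A C E Y0)"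
    and Y: "pos_def (opA_adj A C E Y)" "spectral_norm (fst Y) \<le> \<gamma>" "norm (Y - Ybar) \<le> r"
    and level: "dual_objective A C E G Y0 \<le> dual_objective A C E G Y"
    and beta: "\<beta> = sigma_max (opA_adj A C E) * r + spectral_norm (opA_adj A C E Ybar)"
  shows "lower_bounded (Re (det (opA_adj A C E Y0)) * \<beta> powi (1 - int CARD('n)) *
           exp (- trace_inner G (snd Y0)
                - \<gamma> * sqrt (real CARD('n)) * sigma_max (opA1_adj A) * Re (trace X)))
          (opA_adj A C E Y)" (is "lower_bounded ?a ?P")
    and "inner x (opA_adj A C E Y *v x) \<le> \<beta> * (norm x)\<^sup>2"
    and "0 < \<beta>"
proof -
  let ?sA = "sigma_max (opA_adj A C E)" and ?s1 = "sigma_max (opA1_adj A)" and ?Q = "opA_adj A C E Ybar"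
  have sA: "norm (opA_adj A C E V) \<le> ?sA * norm V" for V
    unfolding sigma_max_def by (rule onorm[OF bounded_linear_opA_adj])
  have sA0: "0 \<le> ?sA" unfolding sigma_max_def by (rule onorm_pos_le[OF bounded_linear_opA_adj])
  have s1: "norm (opA1_adj A V) \<le> ?s1 * norm V" for V
    unfolding sigma_max_def by (rule onorm[OF bounded_linear_opA1_adj])
  have s10: "0 \<le> ?s1" unfolding sigma_max_def by (rule onorm_pos_le[OF bounded_linear_opA1_adj])
  show upper: "inner x (?P *v x) \<le> \<beta> * (norm x)\<^sup>2" for x
  proof -
    have "norm (?P *v x) = norm (opA_adj A C E (Y - Ybar) *v x + ?Q *v x)"
      by (simp add: linear_diff[OF bounded_linear.linear[OF bounded_linear_opA_adj]] matrix_vector_mult_diff_rdistrib)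
    also have "\<dots> \<le> norm (opA_adj A C E (Y - Ybar)) * norm x + spectral_norm ?Q * norm x"
      by (intro norm_triangle_mono norm_matrix_vector_le spectral_norm_bound)
    also have "norm (opA_adj A C E (Y - Ybar)) \<le> ?sA * r"
      using order_trans[OF sA mult_left_mono[OF Y(3) sA0]] .
    finally have "norm (?P *v x) \<le> \<beta> * norm x"
      by (simp add: beta distrib_right mult_right_mono)
    then have "norm x * norm (?P *v x) \<le> norm x * (\<beta> * norm x)" by (rule mult_left_mono) simp
    then show ?thesis using norm_cauchy_schwarz[of x "?P *v x"]
      by (simp add: power2_eq_square mult_ac)
  qed
  show b: "0 < \<beta>"
  proof -
    have "axis undefined 1 \<noteq> (0::complex^'n)" by simp
    with Y(1) upper show ?thesis unfolding pos_def_iff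
      by (metis less_le_trans zero_less_mult_pos2 zero_less_norm_iff zero_less_power)
  qed
  have "inner X (opA1_adj A (fst Y)) \<le> norm X * norm (opA1_adj A (fst Y))"
    by (rule norm_cauchy_schwarz)
  also have "\<dots> \<le> Re (trace X) * (?s1 * (sqrt (real CARD('n)) * \<gamma>))"
  proof (intro mult_mono pos_def_norm_le_trace X order_trans[OF s1] s10)
    show "norm (fst Y) \<le> sqrt (real CARD('n)) * \<gamma>"
      using order_trans[OF norm_le_spectral_norm mult_left_mono[OF Y(2)]] by simp
    show "0 \<le> Re (trace X)" using order_trans[OF norm_ge_zero pos_def_norm_le_trace[OF X(1)]] .
  qed auto
  finally have "inner X (opA1_adj A (fst Y)) \<le> \<gamma> * sqrt (real CARD('n)) * ?s1 * Re (trace X)"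
    by (simp add: mult_ac)
  moreover have "inner G (snd Y) = inner X ?P - inner X (opA1_adj A (fst Y))"
    using opA2_adjoint[OF E, of C X "snd Y"] X(2) by (simp add: opA_adj_def inner_add_right)
  moreover have "0 \<le> inner X ?P" by (rule pos_def_inner_nonneg[OF X(1) Y(1)])
  ultimately have G: "- (\<gamma> * sqrt (real CARD('n)) * ?s1 * Re (trace X)) \<le> inner G (snd Y)" by simp
  let ?e = "- trace_inner G (snd Y0) - \<gamma> * sqrt (real CARD('n)) * ?s1 * Re (trace X)"
  note det = pos_def_det[OF Y0, THEN conjunct2] pos_def_det[OF Y(1), THEN conjunct2]
  have "ln (Re (det (opA_adj A C E Y0))) + ?e \<le> ln (Re (det ?P))"
    using level G by (simp add: dual_objective_def trace_inner_eq_inner)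
  then have "exp (ln (Re (det (opA_adj A C E Y0))) + ?e) \<le> exp (ln (Re (det ?P)))" by simp
  then have "Re (det (opA_adj A C E Y0)) * exp ?e \<le> Re (det ?P)"
    using det by (simp only: exp_add exp_ln)
  moreover have "\<beta> powi (1 - int CARD('n)) = 1 / \<beta> ^ (CARD('n) - 1)"
  proof -
    have "1 - int CARD('n) = - int (CARD('n) - 1)" by (simp add: of_nat_diff Suc_leI)
    then show ?thesis by (simp only: power_int_minus power_int_of_nat inverse_eq_divide)
  qed
  ultimately have "?a \<le> Re (det ?P) / \<beta> ^ (CARD('n) - 1)"
    using b by (simp add: divide_right_mono)
  with lower_bounded_by_det[OF Y(1) b upper] show "lower_bounded ?a ?P"
    by (rule lower_bounded_mono)
qed

text \<open>The variational inequality of the projection, tested at the old iterate, makes the slope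
  along the step at least \<open>\<parallel>Y' - Y\<parallel>\<^sup>2 / \<rho>\<close>, and the step
  size makes the curvature term at most \<open>3/4\<close> of this. Tested at \<open>Z\<close>, it
  gives the last inequality, from which the rate is summed.\<close>

lemma ama_step_ascent:
  fixes A :: "complex^'n^'n" and C :: "complex^'n^'p" and G E :: "complex^'p^'p" and \<rho> :: real
    and Y :: "(complex^'n^'n) \<times> (complex^'p^'p)"
  assumes E: "transpose E = E" "\<And>i j. E $ i $ j \<in> {0, 1}" and G: "hermitian G" and g: "0 < \<gamma>"
    and Y: "hermitian (fst Y)" "hermitian (snd Y)" "spectral_norm (fst Y) \<le> \<gamma>"
      "lower_bounded a (opA_adj A C E Y)"
    and a: "0 < a" and rho: "0 < \<rho>" "\<rho> * (sigma_max (opA_adj A C E))\<^sup>2 \<le> a\<^sup>2"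
  defines "Y' \<equiv> ama_update A C E G \<gamma> \<rho> Y"
  assumes level: "\<And>s. 0 \<le> s \<Longrightarrow> s \<le> 1 \<Longrightarrow> pos_def (opA_adj A C E (Y + s *\<^sub>R (Y' - Y))) \<Longrightarrow>
      dual_objective A C E G Y \<le> dual_objective A C E G (Y + s *\<^sub>R (Y' - Y)) \<Longrightarrow>
      lower_bounded a (opA_adj A C E (Y + s *\<^sub>R (Y' - Y)))"
  shows "lower_bounded a (opA_adj A C E Y')"
    and "dual_objective A C E G Y + (norm (Y' - Y))\<^sup>2 / (4 * \<rho>) \<le> dual_objective A C E G Y'"
    and "\<And>Z. spectral_norm (fst Z) \<le> \<gamma> \<Longrightarrow> pos_def (opA_adj A C E Z) \<Longrightarrow>
      dual_objective A C E G Z - dual_objective A C E G Y'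
        \<le> ((norm (Y - Z))\<^sup>2 - (norm (Y' - Z))\<^sup>2) / (2 * \<rho>) + (norm (Y' - Y))\<^sup>2 / (4 * \<rho>)"
proof -
  let ?P = "opA_adj A C E Y" and ?D = "opA_adj A C E (Y' - Y)" and ?g = "dual_gradient A C E G Y"
  have pd: "pos_def ?P" using lower_bounded_pos_def[OF Y(4) a] .
  note proj = ama_update_projection[OF E G g Y(1,2) pd, where \<rho>=\<rho>, folded Y'_def]
  have lin: "opA_adj A C E (Y + s *\<^sub>R (Y' - Y)) = ?P + s *\<^sub>R ?D" for s
    using bounded_linear.linear[OF bounded_linear_opA_adj[of A C E]]
    by (simp add: linear_add linear_cmul)
  have lin1: "opA_adj A C E Y' = ?P + ?D" using lin[of 1] by simp
  have D: "hermitian ?D"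
    using proj(1,2) Y(1,2) by (intro hermitian_opA_adj E) (auto simp: hermitian_def conj_transpose_diff)
  have slope: "(norm (Y' - Y))\<^sup>2 / \<rho> \<le> inner ?g (Y' - Y)"
  proof -
    have "\<rho> *\<^sub>R ?g + Y - Y' = \<rho> *\<^sub>R ?g - (Y' - Y)" by simp
    then have "inner (\<rho> *\<^sub>R ?g - (Y' - Y)) (Y - Y') \<le> 0"
      using proj(4)[OF Y(3)] by (simp only: add.commute)
    then have "(norm (Y' - Y))\<^sup>2 \<le> \<rho> * inner ?g (Y' - Y)"
      by (simp add: inner_diff_left inner_diff_right power2_norm_eq_inner algebra_simps)
    then show ?thesis using rho(1) by (simp add: field_simps)
  qed
  have normD: "(norm ?D)\<^sup>2 / a\<^sup>2 \<le> (norm (Y' - Y))\<^sup>2 / \<rho>"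
  proof -
    have "norm ?D \<le> sigma_max (opA_adj A C E) * norm (Y' - Y)"
      unfolding sigma_max_def by (rule onorm[OF bounded_linear_opA_adj])
    then have "(norm ?D)\<^sup>2 \<le> (sigma_max (opA_adj A C E))\<^sup>2 * (norm (Y' - Y))\<^sup>2"
      by (metis norm_ge_zero power_mono power_mult_distrib)
    then have "\<rho> * (norm ?D)\<^sup>2 \<le> \<rho> * (sigma_max (opA_adj A C E))\<^sup>2 * (norm (Y' - Y))\<^sup>2"
      using rho(1) by simp
    also have "\<dots> \<le> a\<^sup>2 * (norm (Y' - Y))\<^sup>2" by (rule mult_right_mono[OF rho(2)]) simp
    finally show ?thesis using rho(1) a by (simp add: field_simps)
  qed
  have grad: "inner ?g (Y' - Y) = inner (matrix_inv ?P) ?D - inner G (snd (Y' - Y))"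
    by (rule dual_gradient_inner[OF E(2)])
  have obj: "dual_objective A C E G (Y + s *\<^sub>R (Y' - Y)) = ln (Re (det (?P + s *\<^sub>R ?D)))
      - inner G (snd Y) - s * inner G (snd (Y' - Y)) + real CARD('n)" for s
    unfolding dual_objective_def lin trace_inner_eq_inner by (simp add: inner_add_right)
  have obj0: "dual_objective A C E G Y = ln (Re (det ?P)) - inner G (snd Y) + real CARD('n)"
    by (simp add: dual_objective_def trace_inner_eq_inner)
  have "lower_bounded a (?P + ?D)"
  proof (rule lower_bound_propagates[OF Y(4) a D])
    show "(norm ?D)\<^sup>2 / a\<^sup>2 \<le> inner (matrix_inv ?P) ?D - inner G (snd (Y' - Y))"
      using normD slope grad by simp
    show "lower_bounded a (?P + s *\<^sub>R ?D)"
      if "0 \<le> s" "s \<le> 1" "pos_def (?P + s *\<^sub>R ?D)"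
        "ln (Re (det ?P)) + s * inner G (snd (Y' - Y)) \<le> ln (Re (det (?P + s *\<^sub>R ?D)))" for s
      using level[OF that(1,2)] that(3,4) unfolding lin obj obj0 by simp
  qed
  then show low': "lower_bounded a (opA_adj A C E Y')" by (simp add: lin1)
  have ascent: "inner ?g (Y' - Y) - 3/4 * ((norm (Y' - Y))\<^sup>2 / \<rho>)
      \<le> dual_objective A C E G Y' - dual_objective A C E G Y"
    using log_det_lower_estimate[OF Y(4) \<open>lower_bounded a (?P + ?D)\<close> a] normD grad obj[of 1] obj0
    by simp
  then show "dual_objective A C E G Y + (norm (Y' - Y))\<^sup>2 / (4 * \<rho>) \<le> dual_objective A C E G Y'"
    using slope by simp
  show "dual_objective A C E G Z - dual_objective A C E G Y'
        \<le> ((norm (Y - Z))\<^sup>2 - (norm (Y' - Z))\<^sup>2) / (2 * \<rho>) + (norm (Y' - Y))\<^sup>2 / (4 * \<rho>)"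
    if Z: "spectral_norm (fst Z) \<le> \<gamma>" "pos_def (opA_adj A C E Z)" for Z
  proof -
    have "inner (\<rho> *\<^sub>R ?g - (Y' - Y)) (Z - Y') \<le> 0"
      using proj(4)[OF Z(1)] by (simp add: algebra_simps)
    then have "\<rho> * inner ?g (Z - Y') \<le> inner (Y' - Y) (Z - Y')"
      by (simp add: inner_diff_left)
    also have "\<dots> = ((norm (Y - Z))\<^sup>2 - (norm (Y' - Z))\<^sup>2 - (norm (Y' - Y))\<^sup>2) / 2"
      by (simp add: power2_norm_eq_inner inner_diff_left inner_diff_right inner_commute field_simps)
    finally have "inner ?g (Z - Y') \<le> ((norm (Y - Z))\<^sup>2 - (norm (Y' - Z))\<^sup>2 - (norm (Y' - Y))\<^sup>2) / (2 * \<rho>)"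
      using rho(1) by (simp add: field_simps)
    moreover have "dual_objective A C E G Z - dual_objective A C E G Y \<le> inner ?g (Z - Y)"
      by (rule dual_objective_concave[OF E(2) pd Z(2)])
    moreover have "inner ?g (Z - Y) = inner ?g (Z - Y') + inner ?g (Y' - Y)"
      by (simp add: inner_diff_right)
    moreover have "3/4 * ((norm (Y' - Y))\<^sup>2 / \<rho>) - (norm (Y' - Y))\<^sup>2 / (2 * \<rho>) = (norm (Y' - Y))\<^sup>2 / (4 * \<rho>)"
      using rho(1) by (simp add: field_simps)
    ultimately show ?thesis using ascent by (simp add: diff_divide_distrib)
  qed
qed

theorem mainTheorem5:
  fixes A :: "complex^'n^'n" and C :: "complex^'n^'p"
    and G E :: "complex^'p^'p"
    and \<gamma> \<rho> \<alpha> \<beta> :: real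
    and Ybar :: "(complex^'n^'n) \<times> (complex^'p^'p)"
    and Xbar :: "complex^'n^'n"
    and Y :: "nat \<Rightarrow> (complex^'n^'n) \<times> (complex^'p^'p)"
  assumes "hurwitz A"
    and "hermitian G"
    and "transpose E = E"
    and "\<And>i j. E $ i $ j \<in> {0, 1}"
    and "\<And>i j. E $ i $ j = 0 \<Longrightarrow> G $ i $ j = 0"
    and "0 < \<gamma>"
    and "dual_optimal A C E G \<gamma> Ybar"
    and "Xbar = matrix_inv (opA_adj A C E Ybar)"
    and "pos_def Xbar"
    and "ama_update A C E G \<gamma> \<rho> Ybar = Ybar"
    and "hermitian (fst (Y 0))" and "hermitian (snd (Y 0))"
    and "pos_def (opA_adj A C E (Y 0))"
    and "spectral_norm (fst (Y 0)) \<le> \<gamma>"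
    and "\<beta> = sigma_max (opA_adj A C E) * norm (Y 0 - Ybar) + spectral_norm (opA_adj A C E Ybar)"
    and "\<alpha> = Re (det (opA_adj A C E (Y 0))) * \<beta> powi (1 - int CARD('n)) *
           exp (- trace_inner G (snd (Y 0))
                - \<gamma> * sqrt (real CARD('n)) * sigma_max (opA1_adj A) * Re (trace Xbar))"
    and "0 < \<rho>"
    and "\<rho> \<le> min (2 * \<alpha> ^ 4 / (\<beta>\<^sup>2 * (sigma_max (opA A C E))\<^sup>2))
                 (\<alpha>\<^sup>2 / (sigma_max (opA_adj A C E))\<^sup>2)"
    and "\<And>k. Y (Suc k) = ama_update A C E G \<gamma> \<rho> (Y k)"
  shows "(\<forall>k. dual_feasible A C E \<gamma> (Y k)) \<and>
         (\<lambda>k. dual_objective A C E G (Y k)) \<longlonglongrightarrow> dual_objective A C E G Ybar \<and>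
         (\<exists>c. \<forall>k\<ge>1. dual_objective A C E G Ybar - dual_objective A C E G (Y k) \<le> c / real k)"
proof -
  note E = assms(3,4) and G = assms(2) and fixpt = assms(10) and step = assms(19)
  let ?J = "dual_objective A C E G" and ?L = "opA_adj A C E"
  have feas: "dual_feasible A C E \<gamma> Ybar" and opt: "\<And>Z. dual_feasible A C E \<gamma> Z \<Longrightarrow> ?J Z \<le> ?J Ybar"
    using assms(7) by (auto simp: dual_optimal_def)
  have bar: "hermitian (fst Ybar)" "hermitian (snd Ybar)" "pos_def (?L Ybar)" "spectral_norm (fst Ybar) \<le> \<gamma>"
    using feas by (auto simp: dual_feasible_def)
  have feas0: "dual_feasible A C E \<gamma> (Y 0)" using assms(11-14) by (simp add: dual_feasible_def)
  \<comment> \<open>The second component of the fixed point equation says that the optimum is primal feasible.\<close>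
  have "snd Ybar + \<rho> *\<^sub>R (opA2 C E Xbar - G) = snd Ybar"
    using arg_cong[OF fixpt, of snd] assms(8) by (simp add: ama_update_def Let_def)
  then have XG: "opA2 C E Xbar = G" using assms(17) by simp
  have level: "lower_bounded \<alpha> (?L Z)" "inner x (?L Z *v x) \<le> \<beta> * (norm x)\<^sup>2" "0 < \<beta>"
    if "pos_def (?L Z)" "spectral_norm (fst Z) \<le> \<gamma>" "norm (Z - Ybar) \<le> norm (Y 0 - Ybar)" "?J (Y 0) \<le> ?J Z"
    for Z x
    unfolding assms(16)
    by (rule level_set_lower_bounded[OF E(2) assms(9) XG bar(3) assms(13) that assms(15)])+
  note barlev = level[OF bar(3,4) _ opt[OF feas0], simplified]
  have b: "0 < \<beta>" by (rule barlev(3))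
  have a: "0 < \<alpha>"
    unfolding assms(16) using b pos_def_det[OF assms(13)] by (intro mult_pos_pos zero_less_power_int) auto
  have ab: "\<alpha> \<le> \<beta>"
  proof -
    have n: "norm (axis undefined 1 :: complex^'n) = 1"
      by (simp add: norm_eq_sqrt_inner[of "axis _ _"] inner_axis_axis)
    have "\<alpha> * (norm (axis undefined 1 :: complex^'n))\<^sup>2 \<le> \<beta> * (norm (axis undefined 1 :: complex^'n))\<^sup>2"
      using barlev(1) barlev(2)[of "axis undefined 1"] unfolding lower_bounded_def by (meson order_trans)
    then show ?thesis by (simp add: n)
  qed
  have rho_adj: "\<rho> * (sigma_max ?L)\<^sup>2 \<le> \<alpha>\<^sup>2"
  proof (cases "sigma_max ?L = 0")
    case False
    then show ?thesis using assms(18) by (simp add: pos_le_divide_eq)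
  qed simp
  \<comment> \<open>As \<open>\<alpha> \<le> \<beta>\<close>, the first bound on the step size is at most \<open>2 \<alpha>\<^sup>2 / \<sigma>(\<A>)\<^sup>2\<close>.\<close>
  have rho_op: "\<rho> * (sigma_max (opA A C E))\<^sup>2 \<le> 2 * \<alpha>\<^sup>2"
  proof (cases "sigma_max (opA A C E) = 0")
    case False
    then have "0 < \<beta>\<^sup>2 * (sigma_max (opA A C E))\<^sup>2" using b by simp
    moreover have "\<rho> \<le> 2 * \<alpha> ^ 4 / (\<beta>\<^sup>2 * (sigma_max (opA A C E))\<^sup>2)" using assms(18) by simp
    ultimately have "\<rho> * (\<beta>\<^sup>2 * (sigma_max (opA A C E))\<^sup>2) \<le> 2 * \<alpha> ^ 4"
      by (simp add: pos_le_divide_eq)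
    also have "\<dots> \<le> \<beta>\<^sup>2 * (2 * \<alpha>\<^sup>2)"
    proof -
      have "\<alpha>\<^sup>2 \<le> \<beta>\<^sup>2" using ab a by (intro power_mono) auto
      from mult_right_mono[OF this, of "2 * \<alpha>\<^sup>2"] show ?thesis by (simp add: eval_nat_numeral mult_ac)
    qed
    finally have "\<beta>\<^sup>2 * (\<rho> * (sigma_max (opA A C E))\<^sup>2) \<le> \<beta>\<^sup>2 * (2 * \<alpha>\<^sup>2)" by (simp add: mult_ac)
    then show ?thesis using b by (simp add: mult_le_cancel_left_pos)
  qed simp
  define inv where "inv k \<longleftrightarrow> hermitian (fst (Y k)) \<and> hermitian (snd (Y k)) \<and> spectral_norm (fst (Y k)) \<le> \<gamma> \<and>
    lower_bounded \<alpha> (?L (Y k)) \<and> norm (Y k - Ybar) \<le> norm (Y 0 - Ybar) \<and> ?J (Y 0) \<le> ?J (Y k)" for k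
  have next_step: "inv (Suc k) \<and> ?J (Y k) + (norm (Y (Suc k) - Y k))\<^sup>2 / (4 * \<rho>) \<le> ?J (Y (Suc k)) \<and>
      ?J Ybar - ?J (Y (Suc k)) \<le> ((norm (Y k - Ybar))\<^sup>2 - (norm (Y (Suc k) - Ybar))\<^sup>2) / (2 * \<rho>)
        + (norm (Y (Suc k) - Y k))\<^sup>2 / (4 * \<rho>)" if "inv k" for k
  proof -
    have Yk: "hermitian (fst (Y k))" "hermitian (snd (Y k))" "spectral_norm (fst (Y k)) \<le> \<gamma>"
      "lower_bounded \<alpha> (?L (Y k))" "norm (Y k - Ybar) \<le> norm (Y 0 - Ybar)" "?J (Y 0) \<le> ?J (Y k)"
      using that by (auto simp: inv_def)
    note proj = ama_update_projection[OF E G assms(6) Yk(1,2) lower_bounded_pos_def[OF Yk(4) a], where \<rho>=\<rho>, folded step]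
    note proj' = ama_update_projection[OF E G assms(6) bar(1,2,3), where \<rho>=\<rho>, unfolded fixpt]
    have "norm (Y (Suc k) - Ybar) \<le> norm (Y k - Ybar)"
      using variational_nonexpansive[OF proj(4)[OF bar(4)] proj'(4)[OF proj(3)]]
        gradient_step_nonexpansive[OF E(2) a less_imp_le[OF assms(17)] Yk(4) barlev(1) rho_op]
      by (rule order_trans)
    then have ball: "norm (Y (Suc k) - Ybar) \<le> norm (Y 0 - Ybar)" using Yk(5) by simp
    have seg: "lower_bounded \<alpha> (?L (Y k + s *\<^sub>R (Y (Suc k) - Y k)))"
      if s: "0 \<le> s" "s \<le> 1" and pd: "pos_def (?L (Y k + s *\<^sub>R (Y (Suc k) - Y k)))"
        and J: "?J (Y k) \<le> ?J (Y k + s *\<^sub>R (Y (Suc k) - Y k))" for s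
    proof (rule level(1)[OF pd])
      let ?S = "Y k + s *\<^sub>R (Y (Suc k) - Y k)"
      have conv: "?S = (1 - s) *\<^sub>R Y k + s *\<^sub>R Y (Suc k)" by (simp add: algebra_simps)
      show "spectral_norm (fst (Y k + s *\<^sub>R (Y (Suc k) - Y k))) \<le> \<gamma>"
      proof (rule spectral_norm_leI)
        fix x
        have "fst ?S *v x = (1 - s) *\<^sub>R (fst (Y k) *v x) + s *\<^sub>R (fst (Y (Suc k)) *v x)"
          by (simp only: conv fst_add fst_scaleR matrix_vector_mult_add_rdistrib complex_matrix_scaleR_vector)
        also have "norm \<dots> \<le> (1 - s) * (\<gamma> * norm x) + s * (\<gamma> * norm x)"
          using s order_trans[OF spectral_norm_bound mult_right_mono[OF Yk(3) norm_ge_zero], of x]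
            order_trans[OF spectral_norm_bound mult_right_mono[OF proj(3) norm_ge_zero], of x]
          by (intro norm_triangle_mono) (auto intro: mult_left_mono)
        finally show "norm (fst ?S *v x) \<le> \<gamma> * norm x" by (simp add: algebra_simps)
      qed
      have "?S - Ybar = (1 - s) *\<^sub>R (Y k - Ybar) + s *\<^sub>R (Y (Suc k) - Ybar)"
        by (simp add: algebra_simps)
      also have "norm \<dots> \<le> (1 - s) * norm (Y 0 - Ybar) + s * norm (Y 0 - Ybar)"
        using s Yk(5) ball by (intro norm_triangle_mono) (auto intro: mult_left_mono)
      finally show "norm (Y k + s *\<^sub>R (Y (Suc k) - Y k) - Ybar) \<le> norm (Y 0 - Ybar)"
        by (simp add: algebra_simps)
      show "?J (Y 0) \<le> ?J (Y k + s *\<^sub>R (Y (Suc k) - Y k))" using Yk(6) J by simp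
    qed
    note step_facts = ama_step_ascent[OF E G assms(6) Yk(1-4) a assms(17) rho_adj, folded step]
    have asc: "lower_bounded \<alpha> (?L (Y (Suc k)))"
      "?J (Y k) + (norm (Y (Suc k) - Y k))\<^sup>2 / (4 * \<rho>) \<le> ?J (Y (Suc k))"
      by (rule step_facts, rule seg, assumption+)+
    have "?J Ybar - ?J (Y (Suc k)) \<le> ((norm (Y k - Ybar))\<^sup>2 - (norm (Y (Suc k) - Ybar))\<^sup>2) / (2 * \<rho>)
        + (norm (Y (Suc k) - Y k))\<^sup>2 / (4 * \<rho>)"
      by (rule step_facts(3), rule seg) (use bar in auto)
    moreover
    have "0 \<le> (norm (Y (Suc k) - Y k))\<^sup>2 / (4 * \<rho>)" using assms(17) by simp
    ultimately show ?thesis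
      using proj(1-3) ball asc Yk(6) unfolding inv_def by auto
  qed
  have inv: "inv k" for k
  proof (induction k)
    case 0
    show ?case
      using assms(11-14) level(1)[OF assms(13,14)] by (simp add: inv_def)
  qed (use next_step in blast)
  have feasible: "dual_feasible A C E \<gamma> (Y k)" for k
    using inv[of k] lower_bounded_pos_def[OF _ a] by (auto simp: inv_def dual_feasible_def)
  define c where "c = (norm (Y 0 - Ybar))\<^sup>2 / (2 * \<rho>) + (?J Ybar - ?J (Y 0))"
  have rate: "?J Ybar - ?J (Y k) \<le> c / real k" if "1 \<le> k" for k
    unfolding c_def
  proof (rule telescoping_rate[where r="\<lambda>k. (norm (Y k - Ybar))\<^sup>2 / (2 * \<rho>)", OF _ _ _ _ that])
    fix k
    note s = next_step[OF inv[of k], THEN conjunct2]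
    have pos: "0 \<le> (norm (Y (Suc k) - Y k))\<^sup>2 / (4 * \<rho>)" using assms(17) by simp
    show "0 \<le> (norm (Y k - Ybar))\<^sup>2 / (2 * \<rho>)" using assms(17) by simp
    show "0 \<le> ?J Ybar - ?J (Y k)" using opt[OF feasible] by simp
    show "?J Ybar - ?J (Y (Suc k)) \<le> ?J Ybar - ?J (Y k)" using s pos by linarith
    show "?J Ybar - ?J (Y (Suc k)) \<le> (norm (Y k - Ybar))\<^sup>2 / (2 * \<rho>) - (norm (Y (Suc k) - Ybar))\<^sup>2 / (2 * \<rho>)
        + ((?J Ybar - ?J (Y k)) - (?J Ybar - ?J (Y (Suc k))))"
      using s by (simp add: diff_divide_distrib)
  qed
  have "(\<lambda>k. ?J Ybar - ?J (Y k)) \<longlonglongrightarrow> 0"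
  proof (rule tendsto_sandwich[OF _ _ tendsto_const lim_const_over_n[of c]])
    show "\<forall>\<^sub>F k in sequentially. 0 \<le> ?J Ybar - ?J (Y k)"
      using opt[OF feasible] by simp
    show "\<forall>\<^sub>F k in sequentially. ?J Ybar - ?J (Y k) \<le> c / real k"
      using rate by (auto simp: eventually_sequentially)
  qed
  from tendsto_diff[OF tendsto_const[of "?J Ybar"] this]
  have "(\<lambda>k. ?J (Y k)) \<longlonglongrightarrow> ?J Ybar" by simp
  with feasible rate show ?thesis by blast
qed

end
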